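(* In the system NSA, the following three principles are equivalent: (i) $\mathbb{MP}$: for every $\Sigma_1$-formula $P$, ${\sim}{\sim}P\Rrightarrow P$; (ii) $\mathbb{MPR}$: $(\forall x\in\mathbb{R})\big({\sim}{\sim}(x>0)\Rrightarrow x>0\big)$; (iii) $(\Pi_1\text{-TRANS})_1$: for every $\Delta_0$-formula $\varphi$ (with standard parameters), $(\forall n\in\mathbb{N})\varphi(n)\rightarrow(\forall n\in\mathbb{N}_1)\varphi(n)$.
   Context: Notation: $\mathbb{N}$ standard (finite) numbers, ${}^{*}\mathbb{N}$ nonstandard numbers, $\Omega={}^{*}\mathbb{N}\setminus\mathbb{N}$ infinite numbers; ${}^{*}\varphi$ is the star image of $\varphi$ (often suppressed). A formula is $\Delta_0$ if all quantifiers are bounded by terms and no infinite numbers occur; $\Delta_0$-formulas may contain standard numbers and standard sets as parameters. $\Sigma_1$: $(\exists n\in\mathbb{N})\varphi(n)$ with $\varphi$ $\Delta_0$; $\Pi_1$: $(\forall n\in\mathbb{N})\varphi(n)$. Real numbers: a real is a sequence of rationals $x=(q_n)$ with $(\forall k,i\in\mathbb{N})(|q_k-q_{k+i}|<2^{-k})$; $x\in\mathbb{R}$ denotes this. $x>0$ is the $\Sigma_1$-formula $(\exists n\in\mathbb{N})(q_n>2^{-n})$. The system s-NSA is multi-sorted (standard numbers in $\mathbb{N}$, nonstandard numbers in ${}^{*}\mathbb{N}$, standard sets $\subseteq\mathbb{N}$, nonstandard sets $\subseteq{}^{*}\mathbb{N}$) with axioms: $I\Sigma_1$ and ${}^{*}I\Sigma_1$;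 ${}^{*}\mathbb{N}$ is an end extension of $\mathbb{N}$; the standard structure embeds into the nonstandard one via an injective homomorphism; $\Omega$-CA: for $\Delta_0$ $\psi(n,m)$ and $\omega\in\Omega$, if $(\forall n\in\mathbb{N})(\forall\omega'\in\Omega)[{}^{*}\psi(n,\omega)\leftrightarrow{}^{*}\psi(n,\omega')]$ then $(\exists X\subset\mathbb{N})(\forall n\in\mathbb{N})[{}^{*}\psi(n,\omega)\leftrightarrow n\in X]$; $\Delta_0$-TRANS: $(\forall n\in\mathbb{N})(\forall X\subset\mathbb{N})[\varphi(n,X)\leftrightarrow{}^{*}\varphi(n,X)]$ for $\Delta_0$ $\varphi$; $\Delta_0$-underspill: $(\forall n\in\mathbb{N})(\forall X\subset{}^{*}\mathbb{N})[(\forall\omega\in\Omega){}^{*}\varphi(n,X,\omega)\rightarrow(\exists m\in\mathbb{N})\varphi(n,X,m)]$ for $\Delta_0$ $\varphi$; and the transfer rule (if the system proves $(\forall n\in\mathbb{N})\varphi(n)$ for $\Delta_0$ $\varphi$, it proves $(\forall n\in{}^{*}\mathbb{N}){}^{*}\varphi(n)$). NSA is s-NSA extended with an intermediate level $\mathbb{N}_1$ with $\mathbb{N}\subsetneq\mathbb{N}_1\subsetneq{}^{*}\mathbb{N}$, connected to the other levels by $\Delta_0$-transfer and $\Delta_0$-underspill in the same way as $\mathbb{N}$ and ${}^{*}\mathbb{N}$ are. Elements of $\mathbb{N}_1$ are called 1-finite. The predicate "$A\in\mathbb{T}$" (for $\varphi$ $\Delta_0$): $(\forall n\in\mathbb{N})\varphi(n)\in\mathbb{T}$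 is $(\forall n\in\mathbb{N})\varphi(n)\rightarrow(\forall n\in{}^{*}\mathbb{N})\varphi(n)$; $(\exists n\in{}^{*}\mathbb{N})\varphi(n)\in\mathbb{T}$ is $(\exists n\in{}^{*}\mathbb{N})\varphi(n)\rightarrow(\exists n\in\mathbb{N}_1)\varphi(n)$; $(\forall n\in\mathbb{N})(\exists m\in\mathbb{N})\varphi(n,m)\in\mathbb{T}$ is $(\forall n\in\mathbb{N})(\exists m\in\mathbb{N})\varphi(n,m)\rightarrow(\forall n\in{}^{*}\mathbb{N})(\exists m\in{}^{*}\mathbb{N})[m \text{ is } n\text{-finite}\wedge\varphi(n,m)]$; $(\exists n\in{}^{*}\mathbb{N})(\forall m\in{}^{*}\mathbb{N})\varphi(n,m)\in\mathbb{T}$ is $(\exists n\in{}^{*}\mathbb{N})(\forall m\in{}^{*}\mathbb{N})\varphi(n,m)\rightarrow(\exists n\in\mathbb{N}_1)(\forall m\in{}^{*}\mathbb{N})\varphi(n,m)$; for formulas not suitable for transfer, such as $(\exists n\in\mathbb{N})\varphi(n)$, $(\exists n\in\mathbb{N}_1)\varphi(n)$, $0=1$ and $(\forall n\in{}^{*}\mathbb{N})\varphi(n)$, "$A\in\mathbb{T}$" is the trivial formula $0=0$. Hyperconnectives: $A\Rrightarrow B$ is $[A\wedge A\in\mathbb{T}]\rightarrow[B\wedge B\in\mathbb{T}]$; ${\sim}A$ is $A\Rrightarrow 0=1$.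
   Formalization: NSA is extended by names for the standard sets defined by Δ0-formulas, which may be used as standard set parameters in the transfer rule; with the axioms exactly as listed, (ii) does not imply (iii). The function 2^x is also included in the language. *)

theory Defs
  imports Main
begin

section \<open>Delta-0 formulas\<close>

text \<open>
  A Delta-0 formula is kept independent of the level at which it is read; its star image is
  the same syntax tree read over the nonstandard numbers (see \<open>inst\<close> below).  Number variables
  are de Bruijn indices, set variables are never bound.  In \<open>DAll t \<phi>\<close>, standing for
  \<open>(\<forall>x < t) \<phi>\<close>, the bound \<open>t\<close> is outside the scope of the binder; likewise \<open>DEx\<close>.
  \<open>DExp t\<close> is the power \<open>2\<close> to the \<open>t\<close>.
\<close>

datatype dtm = DVar nat | DZero | DOne | DAdd dtm dtm | DMul dtm dtm | DExp dtm

datatype dfm =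
    DEq dtm dtm | DLt dtm dtm | DMem dtm nat
  | DNeg dfm | DConj dfm dfm | DDisj dfm dfm | DImp dfm dfm
  | DAll dtm dfm | DEx dtm dfm


section \<open>The many-sorted language of NSA\<close>

text \<open>\<open>LN\<close>, \<open>LN1\<close>, \<open>LStar\<close> are the levels of the standard, the 1-finite and all
  nonstandard numbers.\<close>

datatype level = LN | LN1 | LStar

fun rank :: "level \<Rightarrow> nat" where
  "rank LN = 0" | "rank LN1 = 1" | "rank LStar = 2"

datatype sort = Num level | Set level

text \<open>
  Every sort has its own de Bruijn indices: \<open>Var s i\<close> refers to the \<open>i\<close>-th enclosing binder
  of sort \<open>s\<close>.  \<open>Up\<close> embeds a level into the next one, for numbers as well as for sets, so the
  star image of a standard \<open>X\<close> is \<open>Up (Up X)\<close>.  \<open>Cmp \<psi> ts Ss\<close> names the standard set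
  \<open>{n. \<psi>(n, ts, Ss)}\<close> given by comprehension for the Delta-0 formula \<open>\<psi>\<close>,
  so that it can be a parameter in the transfer rule; its defining axiom speaks about standard
  \<open>n\<close> only, and the rule then yields the corresponding description of its star image.
\<close>

datatype tm =
    Var sort nat
  | ZeroT level | OneT level | Add tm tm | Mul tm tm | Exp tm
  | Up tm
  | Cmp dfm "tm list" "tm list"

inductive has_sort :: "tm \<Rightarrow> sort \<Rightarrow> bool" where
  "has_sort (Var s i) s"
| "has_sort (ZeroT l) (Num l)"
| "has_sort (OneT l) (Num l)"
| "has_sort t (Num l) \<Longrightarrow> has_sort u (Num l) \<Longrightarrow> has_sort (Add t u) (Num l)"
| "has_sort t (Num l) \<Longrightarrow> has_sort u (Num l) \<Longrightarrow> has_sort (Mul t u) (Num l)"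
| "has_sort t (Num l) \<Longrightarrow> has_sort (Exp t) (Num l)"
| "has_sort t (Num l) \<Longrightarrow> rank l' = Suc (rank l) \<Longrightarrow> has_sort (Up t) (Num l')"
| "has_sort t (Set l) \<Longrightarrow> rank l' = Suc (rank l) \<Longrightarrow> has_sort (Up t) (Set l')"
| "\<forall>t\<in>set ts. has_sort t (Num LN) \<Longrightarrow> \<forall>S\<in>set Ss. has_sort S (Set LN) \<Longrightarrow>
     has_sort (Cmp \<psi> ts Ss) (Set LN)"

text \<open>Bounded quantifiers \<open>BAll l t A\<close>, \<open>BEx l t A\<close> are separate constructors (with their
  usual meaning as an axiom), so that the unbounded quantifiers of a formula can be read off
  its syntax.  As before, \<open>t\<close> is outside the scope of the binder.\<close>

datatype fm =
    Eq tm tm | Lt tm tm | Mem tm tm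
  | Neg fm | Conj fm fm | Disj fm fm | Imp fm fm
  | BAll level tm fm | BEx level tm fm
  | Forall sort fm | Exists sort fm

abbreviation Iff :: "fm \<Rightarrow> fm \<Rightarrow> fm" where
  "Iff A B \<equiv> Conj (Imp A B) (Imp B A)"

abbreviation nv :: "level \<Rightarrow> nat \<Rightarrow> tm" where "nv l i \<equiv> Var (Num l) i"
abbreviation sv :: "level \<Rightarrow> nat \<Rightarrow> tm" where "sv l i \<equiv> Var (Set l) i"

definition verum :: fm where "verum = Eq (ZeroT LN) (ZeroT LN)"
definition falsum :: fm where "falsum = Eq (ZeroT LN) (OneT LN)"


subsection \<open>Substitution\<close>

primrec subst_tm :: "(sort \<Rightarrow> nat \<Rightarrow> tm) \<Rightarrow> tm \<Rightarrow> tm" where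
  "subst_tm \<theta> (Var s i) = \<theta> s i"
| "subst_tm \<theta> (ZeroT l) = ZeroT l"
| "subst_tm \<theta> (OneT l) = OneT l"
| "subst_tm \<theta> (Add t u) = Add (subst_tm \<theta> t) (subst_tm \<theta> u)"
| "subst_tm \<theta> (Mul t u) = Mul (subst_tm \<theta> t) (subst_tm \<theta> u)"
| "subst_tm \<theta> (Exp t) = Exp (subst_tm \<theta> t)"
| "subst_tm \<theta> (Up t) = Up (subst_tm \<theta> t)"
| "subst_tm \<theta> (Cmp \<psi> ts Ss) = Cmp \<psi> (map (subst_tm \<theta>) ts) (map (subst_tm \<theta>) Ss)"

definition shift :: "sort \<Rightarrow> sort \<Rightarrow> nat \<Rightarrow> tm" where
  "shift s = (\<lambda>s' i. Var s' (if s' = s then Suc i else i))"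

definition lift_tm :: "sort \<Rightarrow> tm \<Rightarrow> tm" where
  "lift_tm s = subst_tm (shift s)"

definition under :: "sort \<Rightarrow> (sort \<Rightarrow> nat \<Rightarrow> tm) \<Rightarrow> sort \<Rightarrow> nat \<Rightarrow> tm" where
  "under s \<theta> = (\<lambda>s' i. if s' = s then (case i of 0 \<Rightarrow> Var s 0 | Suc j \<Rightarrow> lift_tm s (\<theta> s j))
                       else lift_tm s (\<theta> s' i))"

primrec subst :: "(sort \<Rightarrow> nat \<Rightarrow> tm) \<Rightarrow> fm \<Rightarrow> fm" where
  "subst \<theta> (Eq t u) = Eq (subst_tm \<theta> t) (subst_tm \<theta> u)"
| "subst \<theta> (Lt t u) = Lt (subst_tm \<theta> t) (subst_tm \<theta> u)"
| "subst \<theta> (Mem t u) = Mem (subst_tm \<theta> t) (subst_tm \<theta> u)"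
| "subst \<theta> (Neg A) = Neg (subst \<theta> A)"
| "subst \<theta> (Conj A B) = Conj (subst \<theta> A) (subst \<theta> B)"
| "subst \<theta> (Disj A B) = Disj (subst \<theta> A) (subst \<theta> B)"
| "subst \<theta> (Imp A B) = Imp (subst \<theta> A) (subst \<theta> B)"
| "subst \<theta> (BAll l t A) = BAll l (subst_tm \<theta> t) (subst (under (Num l) \<theta>) A)"
| "subst \<theta> (BEx l t A) = BEx l (subst_tm \<theta> t) (subst (under (Num l) \<theta>) A)"
| "subst \<theta> (Forall s A) = Forall s (subst (under s \<theta>) A)"
| "subst \<theta> (Exists s A) = Exists s (subst (under s \<theta>) A)"

definition lift :: "sort \<Rightarrow> fm \<Rightarrow> fm" where
  "lift s = subst (shift s)"

definition subst0 :: "sort \<Rightarrow> tm \<Rightarrow> fm \<Rightarrow> fm" where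
  "subst0 s t = subst (\<lambda>s' i. if s' = s then (case i of 0 \<Rightarrow> t | Suc j \<Rightarrow> Var s j) else Var s' i)"


subsection \<open>Delta-0 formulas at a level\<close>

definition embed :: "level \<Rightarrow> level \<Rightarrow> tm \<Rightarrow> tm" where
  "embed l l' t = (Up ^^ (rank l' - rank l)) t"

primrec inst_tm :: "level \<Rightarrow> (nat \<Rightarrow> tm) \<Rightarrow> dtm \<Rightarrow> tm" where
  "inst_tm l \<nu> (DVar i) = \<nu> i"
| "inst_tm l \<nu> DZero = ZeroT l"
| "inst_tm l \<nu> DOne = OneT l"
| "inst_tm l \<nu> (DAdd t u) = Add (inst_tm l \<nu> t) (inst_tm l \<nu> u)"
| "inst_tm l \<nu> (DMul t u) = Mul (inst_tm l \<nu> t) (inst_tm l \<nu> u)"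
| "inst_tm l \<nu> (DExp t) = Exp (inst_tm l \<nu> t)"

definition bind :: "level \<Rightarrow> (nat \<Rightarrow> tm) \<Rightarrow> nat \<Rightarrow> tm" where
  "bind l \<nu> = (\<lambda>i. case i of 0 \<Rightarrow> nv l 0 | Suc j \<Rightarrow> lift_tm (Num l) (\<nu> j))"

text \<open>\<open>inst l \<nu> \<sigma> \<phi>\<close> is \<open>\<phi>\<close> read at level \<open>l\<close>, with the level-\<open>l\<close> terms \<open>\<nu>\<close>, \<open>\<sigma>\<close> for its free
  number and set variables.\<close>

primrec inst :: "level \<Rightarrow> (nat \<Rightarrow> tm) \<Rightarrow> (nat \<Rightarrow> tm) \<Rightarrow> dfm \<Rightarrow> fm" where
  "inst l \<nu> \<sigma> (DEq t u) = Eq (inst_tm l \<nu> t) (inst_tm l \<nu> u)"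
| "inst l \<nu> \<sigma> (DLt t u) = Lt (inst_tm l \<nu> t) (inst_tm l \<nu> u)"
| "inst l \<nu> \<sigma> (DMem t j) = Mem (inst_tm l \<nu> t) (\<sigma> j)"
| "inst l \<nu> \<sigma> (DNeg \<phi>) = Neg (inst l \<nu> \<sigma> \<phi>)"
| "inst l \<nu> \<sigma> (DConj \<phi> \<psi>) = Conj (inst l \<nu> \<sigma> \<phi>) (inst l \<nu> \<sigma> \<psi>)"
| "inst l \<nu> \<sigma> (DDisj \<phi> \<psi>) = Disj (inst l \<nu> \<sigma> \<phi>) (inst l \<nu> \<sigma> \<psi>)"
| "inst l \<nu> \<sigma> (DImp \<phi> \<psi>) = Imp (inst l \<nu> \<sigma> \<phi>) (inst l \<nu> \<sigma> \<psi>)"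
| "inst l \<nu> \<sigma> (DAll t \<phi>) = BAll l (inst_tm l \<nu> t) (inst l (bind l \<nu>) (\<lambda>j. lift_tm (Num l) (\<sigma> j)) \<phi>)"
| "inst l \<nu> \<sigma> (DEx t \<phi>) = BEx l (inst_tm l \<nu> t) (inst l (bind l \<nu>) (\<lambda>j. lift_tm (Num l) (\<sigma> j)) \<phi>)"

text \<open>
  \<open>app l (lp, k) (ls, m) ts \<phi>\<close> is \<open>\<phi>(ts)\<close> at level \<open>l\<close>.  The remaining free variables of \<open>\<phi>\<close> are
  parameters: number parameters from level \<open>lp\<close> and set parameters from level \<open>ls\<close>, embedded
  into \<open>l\<close>.  Here \<open>k\<close> and \<open>m\<close> must be the numbers of enclosing binders of sort \<open>Num lp\<close> and
  \<open>Set ls\<close>.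
\<close>

fun app :: "level \<Rightarrow> level \<times> nat \<Rightarrow> level \<times> nat \<Rightarrow> tm list \<Rightarrow> dfm \<Rightarrow> fm" where
  "app l (lp, k) (ls, m) ts \<phi> =
     inst l (\<lambda>i. if i < length ts then ts ! i else embed lp l (nv lp (i - length ts + k)))
            (\<lambda>j. embed ls l (sv ls (j + m))) \<phi>"

text \<open>\<open>inLevel l l' t\<close>: the number \<open>t\<close> of level \<open>l'\<close> belongs to level \<open>l\<close>.\<close>

definition inLevel :: "level \<Rightarrow> level \<Rightarrow> tm \<Rightarrow> fm" where
  "inLevel l l' t = Exists (Num l) (Eq (lift_tm (Num l) t) (embed l l' (nv l 0)))"


section \<open>The system NSA\<close>

text \<open>Axioms are open formulas; their free variables are implicitly universally quantified.\<close>

definition basic_axioms :: "level \<Rightarrow> fm set" where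
  "basic_axioms l =
    (let x = nv l 0; y = nv l 1; zr = ZeroT l; un = OneT l in
     {Neg (Eq (Add x un) zr),
      Imp (Eq (Add x un) (Add y un)) (Eq x y),
      Eq (Add x zr) x,
      Eq (Add x (Add y un)) (Add (Add x y) un),
      Eq (Mul x zr) zr,
      Eq (Mul x (Add y un)) (Add (Mul x y) x),
      Neg (Lt x zr),
      Iff (Lt x (Add y un)) (Disj (Lt x y) (Eq x y)),
      Eq (Exp zr) un,
      Eq (Exp (Add x un)) (Add (Exp x) (Exp x))})"

text \<open>\<open>Sig1 l k t \<phi>\<close> is \<open>\<exists>m. \<phi>(m, t)\<close>, all at level \<open>l\<close>, below \<open>k\<close> binders of sort \<open>Num l\<close>.\<close>

definition Sig1 :: "level \<Rightarrow> nat \<Rightarrow> tm \<Rightarrow> dfm \<Rightarrow> fm" where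
  "Sig1 l k t \<phi> = Exists (Num l) (app l (l, Suc k) (l, 0) [nv l 0, lift_tm (Num l) t] \<phi>)"

definition Sigma1_induction :: "level \<Rightarrow> fm set" where
  "Sigma1_induction l =
    {Imp (Conj (Sig1 l 0 (ZeroT l) \<phi>)
               (Forall (Num l) (Imp (Sig1 l 1 (nv l 0) \<phi>) (Sig1 l 1 (Add (nv l 0) (OneT l)) \<phi>))))
         (Forall (Num l) (Sig1 l 1 (nv l 0) \<phi>)) | \<phi>. True}"

definition ISigma1 :: "level \<Rightarrow> fm set" where
  "ISigma1 l = basic_axioms l \<union> Sigma1_induction l"

text \<open>The embedding of level \<open>l\<close> into the next level \<open>l'\<close> is an injective homomorphism.\<close>

definition embedding_axioms :: "level \<Rightarrow> level \<Rightarrow> fm set" where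
  "embedding_axioms l l' =
    (let x = nv l 0; y = nv l 1; X = sv l 0 in
     {Eq (Up (ZeroT l)) (ZeroT l'),
      Eq (Up (OneT l)) (OneT l'),
      Eq (Up (Add x y)) (Add (Up x) (Up y)),
      Eq (Up (Mul x y)) (Mul (Up x) (Up y)),
      Eq (Up (Exp x)) (Exp (Up x)),
      Iff (Lt x y) (Lt (Up x) (Up y)),
      Iff (Mem x X) (Mem (Up x) (Up X)),
      Imp (Eq (Up x) (Up y)) (Eq x y)})"

definition end_extension :: fm where
  "end_extension = Imp (Lt (nv LStar 0) (embed LN LStar (nv LN 0))) (inLevel LN LStar (nv LStar 0))"

definition proper_inclusion :: "level \<Rightarrow> level \<Rightarrow> fm" where
  "proper_inclusion l l' = Exists (Num l') (Neg (inLevel l l' (nv l' 0)))"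

abbreviation infinite_number :: "tm \<Rightarrow> fm" where
  "infinite_number t \<equiv> Neg (inLevel LN LStar t)"

definition Omega_CA :: "dfm \<Rightarrow> fm" where
  "Omega_CA \<psi> =
    Forall (Num LStar) (Imp (infinite_number (nv LStar 0))
      (Imp
        (Forall (Num LN) (Forall (Num LStar) (Imp (infinite_number (nv LStar 0))
          (Iff (app LStar (LN, 1) (LN, 0) [embed LN LStar (nv LN 0), nv LStar 1] \<psi>)
               (app LStar (LN, 1) (LN, 0) [embed LN LStar (nv LN 0), nv LStar 0] \<psi>)))))
        (Exists (Set LN) (Forall (Num LN)
          (Iff (app LStar (LN, 1) (LN, 1) [embed LN LStar (nv LN 0), nv LStar 0] \<psi>)
               (Mem (nv LN 0) (sv LN 0)))))))"

definition Delta0_TRANS :: "level \<Rightarrow> level \<Rightarrow> dfm \<Rightarrow> fm" where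
  "Delta0_TRANS l l' \<phi> = Iff (app l (l, 0) (l, 0) [] \<phi>) (app l' (l, 0) (l, 0) [] \<phi>)"

definition Delta0_underspill :: "level \<Rightarrow> level \<Rightarrow> dfm \<Rightarrow> fm" where
  "Delta0_underspill l l' \<phi> =
    Imp (Forall (Num l') (Imp (Neg (inLevel l l' (nv l' 0)))
                              (app l' (l, 0) (l', 0) [nv l' 0] \<phi>)))
        (Exists (Num l) (app l' (l, 1) (l', 0) [embed l l' (nv l 0)] \<phi>))"

text \<open>Defining axiom of a comprehension term.  Missing arguments default to \<open>0\<close> and the
  empty set.\<close>

definition Cmp_axiom :: "dfm \<Rightarrow> tm list \<Rightarrow> tm list \<Rightarrow> fm" where
  "Cmp_axiom \<psi> ts Ss =
    Forall (Num LN)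
      (Iff (Mem (nv LN 0) (lift_tm (Num LN) (Cmp \<psi> ts Ss)))
           (inst LN
             (bind LN (\<lambda>i. if i < length ts then ts ! i else ZeroT LN))
             (\<lambda>j. lift_tm (Num LN) (if j < length Ss then Ss ! j else Cmp (DNeg (DEq DZero DZero)) [] []))
             \<psi>))"

inductive_set NSA_axioms :: "fm set" where
  "A \<in> ISigma1 LN \<Longrightarrow> A \<in> NSA_axioms"
| "A \<in> ISigma1 LStar \<Longrightarrow> A \<in> NSA_axioms"
| "rank l' = Suc (rank l) \<Longrightarrow> A \<in> embedding_axioms l l' \<Longrightarrow> A \<in> NSA_axioms"
| "end_extension \<in> NSA_axioms"
| "rank l' = Suc (rank l) \<Longrightarrow> proper_inclusion l l' \<in> NSA_axioms"
| "Omega_CA \<psi> \<in> NSA_axioms"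
| "rank l < rank l' \<Longrightarrow> Delta0_TRANS l l' \<phi> \<in> NSA_axioms"
| "rank l < rank l' \<Longrightarrow> Delta0_underspill l l' \<phi> \<in> NSA_axioms"
| "has_sort (Cmp \<psi> ts Ss) (Set LN) \<Longrightarrow> Cmp_axiom \<psi> ts Ss \<in> NSA_axioms"


subsection \<open>Formulas with an unbounded quantifier prefix\<close>

text \<open>In each of these, \<open>\<phi>\<close> is Delta-0; its first variable(s) are the quantified ones and all
  other free variables are standard parameters.\<close>

definition binders :: "level \<Rightarrow> nat" where
  "binders l = (if l = LN then 1 else 0)"

definition AllQ :: "level \<Rightarrow> dfm \<Rightarrow> fm" where
  "AllQ l \<phi> = Forall (Num l) (app l (LN, binders l) (LN, 0) [nv l 0] \<phi>)"

definition ExQ :: "level \<Rightarrow> dfm \<Rightarrow> fm" where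
  "ExQ l \<phi> = Exists (Num l) (app l (LN, binders l) (LN, 0) [nv l 0] \<phi>)"

text \<open>\<open>(\<forall>n \<in> N)(\<exists>m \<in> N) \<phi>(n, m)\<close>\<close>

definition AllExN :: "dfm \<Rightarrow> fm" where
  "AllExN \<phi> = Forall (Num LN) (Exists (Num LN) (app LN (LN, 2) (LN, 0) [nv LN 1, nv LN 0] \<phi>))"

text \<open>\<open>m\<close> is \<open>n\<close>-finite if it belongs to every level to which \<open>n\<close> belongs.\<close>

definition n_finite :: "tm \<Rightarrow> tm \<Rightarrow> fm" where
  "n_finite n m = Conj (Imp (inLevel LN LStar n) (inLevel LN LStar m))
                       (Imp (inLevel LN1 LStar n) (inLevel LN1 LStar m))"

definition AllExStar_finite :: "dfm \<Rightarrow> fm" where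
  "AllExStar_finite \<phi> =
    Forall (Num LStar) (Exists (Num LStar)
      (Conj (n_finite (nv LStar 1) (nv LStar 0))
            (app LStar (LN, 0) (LN, 0) [nv LStar 1, nv LStar 0] \<phi>)))"

definition ExAllStar :: "dfm \<Rightarrow> fm" where
  "ExAllStar \<phi> =
    Exists (Num LStar) (Forall (Num LStar)
      (app LStar (LN, 0) (LN, 0) [nv LStar 1, nv LStar 0] \<phi>))"

text \<open>\<open>(\<exists>n \<in> N\<^sub>1)(\<forall>m \<in> *N) \<phi>(n, m)\<close>\<close>

definition ExN1_AllStar :: "dfm \<Rightarrow> fm" where
  "ExN1_AllStar \<phi> =
    Exists (Num LN1) (Forall (Num LStar)
      (app LStar (LN, 0) (LN, 0) [embed LN1 LStar (nv LN1 0), nv LStar 0] \<phi>))"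


subsection \<open>Provability\<close>

text \<open>
  \<open>proves H \<Gamma> A\<close>: the formula \<open>A\<close> is derivable, in classical many-sorted natural deduction with
  equality, in NSA extended by the axioms \<open>H\<close>, from the local assumptions \<open>\<Gamma>\<close>.  The free
  variables of \<open>H\<close>, unlike those of \<open>\<Gamma>\<close>, are implicitly universally quantified.  The transfer
  rule applies to theorems of NSA proper only; its substitution \<open>\<theta>\<close> puts standard numbers and
  standard sets for the parameters of \<open>\<phi>\<close>.
\<close>

inductive proves :: "fm set \<Rightarrow> fm set \<Rightarrow> fm \<Rightarrow> bool" where
  Assumption: "A \<in> \<Gamma> \<Longrightarrow> proves H \<Gamma> A"
| NSA_axiom: "A \<in> NSA_axioms \<Longrightarrow> proves H \<Gamma> A"
| Extra_axiom: "A \<in> H \<Longrightarrow> proves H \<Gamma> A"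
| Transfer_rule: "proves {} {} (subst \<theta> (AllQ LN \<phi>)) \<Longrightarrow> (\<forall>s i. has_sort (\<theta> s i) s) \<Longrightarrow>
    proves H \<Gamma> (subst \<theta> (AllQ LStar \<phi>))"
| Conj_I: "proves H \<Gamma> A \<Longrightarrow> proves H \<Gamma> B \<Longrightarrow> proves H \<Gamma> (Conj A B)"
| Conj_E1: "proves H \<Gamma> (Conj A B) \<Longrightarrow> proves H \<Gamma> A"
| Conj_E2: "proves H \<Gamma> (Conj A B) \<Longrightarrow> proves H \<Gamma> B"
| Disj_I1: "proves H \<Gamma> A \<Longrightarrow> proves H \<Gamma> (Disj A B)"
| Disj_I2: "proves H \<Gamma> B \<Longrightarrow> proves H \<Gamma> (Disj A B)"
| Disj_E: "proves H \<Gamma> (Disj A B) \<Longrightarrow> proves H (insert A \<Gamma>) C \<Longrightarrow> proves H (insert B \<Gamma>) C \<Longrightarrow>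
    proves H \<Gamma> C"
| Imp_I: "proves H (insert A \<Gamma>) B \<Longrightarrow> proves H \<Gamma> (Imp A B)"
| Imp_E: "proves H \<Gamma> (Imp A B) \<Longrightarrow> proves H \<Gamma> A \<Longrightarrow> proves H \<Gamma> B"
| Neg_I: "proves H (insert A \<Gamma>) B \<Longrightarrow> proves H (insert A \<Gamma>) (Neg B) \<Longrightarrow> proves H \<Gamma> (Neg A)"
| Classical: "proves H (insert (Neg A) \<Gamma>) B \<Longrightarrow> proves H (insert (Neg A) \<Gamma>) (Neg B) \<Longrightarrow>
    proves H \<Gamma> A"
| Forall_I: "proves H (lift s ` \<Gamma>) A \<Longrightarrow> proves H \<Gamma> (Forall s A)"
| Forall_E: "proves H \<Gamma> (Forall s A) \<Longrightarrow> has_sort t s \<Longrightarrow> proves H \<Gamma> (subst0 s t A)"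
| Exists_I: "proves H \<Gamma> (subst0 s t A) \<Longrightarrow> has_sort t s \<Longrightarrow> proves H \<Gamma> (Exists s A)"
| Exists_E: "proves H \<Gamma> (Exists s A) \<Longrightarrow> proves H (insert A (lift s ` \<Gamma>)) (lift s B) \<Longrightarrow> proves H \<Gamma> B"
| Eq_refl: "has_sort t (Num l) \<Longrightarrow> proves H \<Gamma> (Eq t t)"
| Eq_subst: "proves H \<Gamma> (Eq t u) \<Longrightarrow> proves H \<Gamma> (subst0 (Num l) t A) \<Longrightarrow>
    has_sort t (Num l) \<Longrightarrow> has_sort u (Num l) \<Longrightarrow> proves H \<Gamma> (subst0 (Num l) u A)"
| Bounded_all: "has_sort t (Num l) \<Longrightarrow>
    proves H \<Gamma> (Iff (BAll l t A)
                      (Forall (Num l) (Imp (Lt (nv l 0) (lift_tm (Num l) t)) A)))"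
| Bounded_ex: "has_sort t (Num l) \<Longrightarrow>
    proves H \<Gamma> (Iff (BEx l t A)
                      (Exists (Num l) (Conj (Lt (nv l 0) (lift_tm (Num l) t)) A)))"

text \<open>Two principles, given as sets of instances, are equivalent in NSA if NSA with either one
  proves every instance of the other.\<close>

definition NSA_equivalent :: "fm set \<Rightarrow> fm set \<Rightarrow> bool" where
  "NSA_equivalent P Q \<longleftrightarrow> (\<forall>A\<in>Q. proves P {} A) \<and> (\<forall>A\<in>P. proves Q {} A)"


section \<open>Hyperconnectives\<close>

text \<open>For a formula suitable for transfer, \<open>transferred\<close> is the conclusion of the implication
  that expresses its membership in T.\<close>

definition transferred :: "fm \<Rightarrow> fm option" where
  "transferred A =
    (if A \<in> range (AllQ LN) then Some (AllQ LStar (inv (AllQ LN) A))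
     else if A \<in> range (ExQ LStar) then Some (ExQ LN1 (inv (ExQ LStar) A))
     else if A \<in> range AllExN then Some (AllExStar_finite (inv AllExN A))
     else if A \<in> range ExAllStar then Some (ExN1_AllStar (inv ExAllStar A))
     else None)"

definition inT_nf :: "fm \<Rightarrow> fm" where
  "inT_nf A = (case transferred A of Some B \<Rightarrow> Imp A B | None \<Rightarrow> verum)"

text \<open>
  Membership in T depends on the quantifier form of a formula, whereas \<open>\<sim>P\<close> for
  \<open>P = (\<exists>n \<in> N) \<phi>(n)\<close> is literally the implication \<open>(P \<and> 0=0) \<rightarrow> (0=1 \<and> 0=0)\<close>; it is to be
  treated as \<open>(\<forall>n \<in> N) \<not>\<phi>(n)\<close>.  The function \<open>nf\<close> computes this form: it contracts
  \<open>B \<and> B \<in> T\<close> to what it amounts to (\<open>B\<close> if \<open>B \<in> T\<close> is trivial, and the transferred formula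
  otherwise), reads \<open>B \<rightarrow> 0=1\<close> as \<open>\<not>B\<close>, and moves negations inside the unbounded quantifiers.
\<close>

fun push_neg :: "fm \<Rightarrow> fm" where
  "push_neg (Forall s A) = Exists s (push_neg A)"
| "push_neg (Exists s A) = Forall s (push_neg A)"
| "push_neg A = Neg A"

definition nf_conj :: "fm \<Rightarrow> fm \<Rightarrow> fm" where
  "nf_conj A B = (if B = inT_nf A then (case transferred A of Some A' \<Rightarrow> A' | None \<Rightarrow> A)
                  else Conj A B)"

definition nf_imp :: "fm \<Rightarrow> fm \<Rightarrow> fm" where
  "nf_imp A B = (if B = falsum then push_neg A else Imp A B)"

fun nf :: "fm \<Rightarrow> fm" where
  "nf (Neg A) = push_neg (nf A)"
| "nf (Conj A B) = nf_conj (nf A) (nf B)"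
| "nf (Imp A B) = nf_imp (nf A) (nf B)"
| "nf A = A"

definition inT :: "fm \<Rightarrow> fm" where
  "inT A = inT_nf (nf A)"

definition hyper_imp :: "fm \<Rightarrow> fm \<Rightarrow> fm" where
  "hyper_imp A B = Imp (Conj A (inT A)) (Conj B (inT B))"

definition hyper_neg :: "fm \<Rightarrow> fm" where
  "hyper_neg A = hyper_imp A falsum"


section \<open>Real numbers\<close>

definition dpair :: "dtm \<Rightarrow> dtm \<Rightarrow> dtm" where
  "dpair s t = DAdd (DMul (DAdd s t) (DAdd s t)) s"

text \<open>A rational is coded by three numbers \<open>a, b, d\<close>, standing for \<open>(a - b) / (d + 1)\<close>, and a
  sequence \<open>(q\<^sub>n)\<close> of rationals by the set of all \<open>entry n a b d\<close> with \<open>q\<^sub>n\<close> coded by \<open>a, b, d\<close>.\<close>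

definition entry :: "dtm \<Rightarrow> dtm \<Rightarrow> dtm \<Rightarrow> dtm \<Rightarrow> dtm" where
  "entry n a b d = dpair n (dpair (dpair a b) d)"

text \<open>\<open>2\<^sup>k ((a - b)/(d + 1) - (a' - b')/(d' + 1)) < 1\<close>, cleared of denominators and subtractions\<close>

definition close_below :: "dtm \<Rightarrow> dtm \<Rightarrow> dtm \<Rightarrow> dtm \<Rightarrow> dtm \<Rightarrow> dtm \<Rightarrow> dtm \<Rightarrow> dfm" where
  "close_below k a b d a' b' d' =
    (let D = DAdd d DOne; D' = DAdd d' DOne in
     DLt (DMul (DExp k) (DAdd (DMul a D') (DMul b' D)))
         (DAdd (DMul (DExp k) (DAdd (DMul b D') (DMul a' D))) (DMul D D')))"

text \<open>The formulas below have one free variable, the standard set \<open>sv LN 0\<close>.\<close>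

definition std :: "dfm \<Rightarrow> fm" where
  "std \<phi> = app LN (LN, 0) (LN, 0) [] \<phi>"

abbreviation AllN :: "nat \<Rightarrow> fm \<Rightarrow> fm" where "AllN k \<equiv> Forall (Num LN) ^^ k"
abbreviation ExN :: "nat \<Rightarrow> fm \<Rightarrow> fm" where "ExN k \<equiv> Exists (Num LN) ^^ k"

definition is_rat_sequence :: fm where
  "is_rat_sequence =
    Conj (AllN 1 (Imp (std (DMem (DVar 0) 0))
           (ExN 4 (std (DEq (DVar 4) (entry (DVar 3) (DVar 2) (DVar 1) (DVar 0)))))))
   (Conj (AllN 1 (ExN 3 (std (DMem (entry (DVar 3) (DVar 2) (DVar 1) (DVar 0)) 0))))
         (AllN 7 (std
           (DImp (DConj (DMem (entry (DVar 6) (DVar 5) (DVar 4) (DVar 3)) 0)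
                        (DMem (entry (DVar 6) (DVar 2) (DVar 1) (DVar 0)) 0))
                 (DConj (DEq (DVar 5) (DVar 2))
                 (DConj (DEq (DVar 4) (DVar 1)) (DEq (DVar 3) (DVar 0))))))))"

text \<open>\<open>|q\<^sub>k - q\<^sub>k\<^sub>+\<^sub>i| < 2\<^sup>-\<^sup>k\<close>, with \<open>k, i\<close> the variables 7 and 6\<close>

definition is_real :: fm where
  "is_real =
    Conj is_rat_sequence
      (AllN 8 (std
        (DImp (DConj (DMem (entry (DVar 7) (DVar 5) (DVar 4) (DVar 3)) 0)
                     (DMem (entry (DAdd (DVar 7) (DVar 6)) (DVar 2) (DVar 1) (DVar 0)) 0))
              (DConj (close_below (DVar 7) (DVar 5) (DVar 4) (DVar 3) (DVar 2) (DVar 1) (DVar 0))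
                     (close_below (DVar 7) (DVar 2) (DVar 1) (DVar 0) (DVar 5) (DVar 4) (DVar 3))))))"

text \<open>
  \<open>(\<exists>n \<in> N)(q\<^sub>n > 2\<^sup>-\<^sup>n)\<close>, with the quantifiers over \<open>n\<close> and over the code of \<open>q\<^sub>n\<close> contracted
  to a single one over \<open>p = entry n a b d\<close>, the \<open>n, a, b, d \<le> p\<close> being bounded.
\<close>

definition positive :: fm where
  "positive =
    ExQ LN
      (DEx (DAdd (DVar 0) DOne) (DEx (DAdd (DVar 1) DOne)
      (DEx (DAdd (DVar 2) DOne) (DEx (DAdd (DVar 3) DOne)
        (let p = DVar 4; n = DVar 3; a = DVar 2; b = DVar 1; d = DVar 0 in
         DConj (DEq p (entry n a b d))
        (DConj (DMem p 0)
               (DLt (DAdd (DMul b (DExp n)) (DAdd d DOne)) (DMul a (DExp n)))))))))"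


section \<open>The three principles\<close>

definition MP :: "fm set" where
  "MP = {hyper_imp (hyper_neg (hyper_neg P)) P | P. P \<in> range (ExQ LN)}"

definition MPR :: fm where
  "MPR = Forall (Set LN) (Imp is_real (hyper_imp (hyper_neg (hyper_neg positive)) positive))"

definition Pi1_TRANS_1 :: "fm set" where
  "Pi1_TRANS_1 = {Imp (AllQ LN \<phi>) (AllQ LN1 \<phi>) | \<phi>. True}"


section \<open>The form of the hypernegations\<close>

text \<open>The two hypernegations of \<open>P = (\<exists>n \<in> N) \<phi>(n)\<close> have the forms \<open>(\<forall>n \<in> N) \<not>\<phi>(n)\<close> and
  \<open>(\<exists>n \<in> *N) \<not>\<not>\<phi>(n)\<close>, which gives the expected membership in T.\<close>

lemma lift_tm_Up: "lift_tm s ((Up ^^ k) t) = (Up ^^ k) (lift_tm s t)"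
  by (induction k) (simp_all add: lift_tm_def)

lemma funpow_Up_Var_eq:
  "(Up ^^ k) (Var s i) = (Up ^^ k') (Var s' i') \<longleftrightarrow> k = k' \<and> s = s' \<and> i = i'"
proof (induction k arbitrary: k')
  case 0 then show ?case by (cases k') auto
next
  case (Suc k) then show ?case by (cases k') auto
qed

definition param_terms :: "(nat \<Rightarrow> tm) \<Rightarrow> bool" where
  "param_terms \<nu> \<longleftrightarrow> inj \<nu> \<and> (\<forall>i. \<exists>k s j. \<nu> i = (Up ^^ k) (Var s j))"

lemma lift_tm_param_inj:
  assumes "lift_tm s ((Up ^^ k) (Var r i)) = lift_tm s ((Up ^^ k') (Var r' i'))"
  shows "(Up ^^ k) (Var r i) = (Up ^^ k') (Var r' i')"
  using assms
  by (auto simp: lift_tm_Up) (auto simp: lift_tm_def shift_def funpow_Up_Var_eq split: if_splits)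

lemma param_terms_lift:
  assumes "param_terms \<nu>"
  shows "param_terms (\<lambda>j. lift_tm s (\<nu> j))"
  unfolding param_terms_def
proof (intro conjI allI)
  show "inj (\<lambda>j. lift_tm s (\<nu> j))"
  proof (rule injI)
    fix i j assume eq: "lift_tm s (\<nu> i) = lift_tm s (\<nu> j)"
    obtain k r m k' r' m' where "\<nu> i = (Up ^^ k) (Var r m)" "\<nu> j = (Up ^^ k') (Var r' m')"
      using assms unfolding param_terms_def by metis
    with eq have "\<nu> i = \<nu> j" using lift_tm_param_inj by metis
    then show "i = j" using assms by (auto simp: param_terms_def inj_def)
  qed
next
  fix i
  obtain k r m where "\<nu> i = (Up ^^ k) (Var r m)"
    using assms unfolding param_terms_def by metis
  then have "lift_tm s (\<nu> i) = (Up ^^ k) (Var r (if r = s then Suc m else m))"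
    by (simp add: lift_tm_Up) (simp add: lift_tm_def shift_def)
  then show "\<exists>k r j. lift_tm s (\<nu> i) = (Up ^^ k) (Var r j)" by blast
qed

lemma param_terms_bind:
  assumes "param_terms \<nu>"
  shows "param_terms (bind l \<nu>)"
proof -
  have p: "param_terms (\<lambda>j. lift_tm (Num l) (\<nu> j))" by (rule param_terms_lift[OF assms])
  have ne: "lift_tm (Num l) (\<nu> j) \<noteq> nv l 0" for j
  proof -
    obtain k r m where "\<nu> j = (Up ^^ k) (Var r m)"
      using assms unfolding param_terms_def by metis
    then have "lift_tm (Num l) (\<nu> j) = (Up ^^ k) (Var r (if r = Num l then Suc m else m))"
      by (simp add: lift_tm_Up) (simp add: lift_tm_def shift_def)
    then show ?thesis
      using funpow_Up_Var_eq[of k r "if r = Num l then Suc m else m" 0 "Num l" 0] by auto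
  qed
  have i: "inj (bind l \<nu>)"
    using p ne unfolding param_terms_def inj_def bind_def
    by (auto split: nat.splits) metis
  have "\<exists>k s j. bind l \<nu> i = (Up ^^ k) (Var s j)" for i
  proof (cases i)
    case 0
    then have "bind l \<nu> i = (Up ^^ 0) (Var (Num l) 0)" by (simp add: bind_def)
    then show ?thesis by blast
  next
    case (Suc j) then show ?thesis using p by (simp add: bind_def param_terms_def)
  qed
  with i show ?thesis by (simp add: param_terms_def)
qed

lemma param_terms_neq:
  assumes "param_terms \<nu>"
  shows "\<nu> i \<noteq> ZeroT l" "\<nu> i \<noteq> OneT l" "\<nu> i \<noteq> Add t u" "\<nu> i \<noteq> Mul t u" "\<nu> i \<noteq> Exp t"
proof -
  obtain k s j where *: "\<nu> i = (Up ^^ k) (Var s j)"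
    using assms unfolding param_terms_def by metis
  show "\<nu> i \<noteq> ZeroT l" "\<nu> i \<noteq> OneT l" "\<nu> i \<noteq> Add t u" "\<nu> i \<noteq> Mul t u" "\<nu> i \<noteq> Exp t"
    unfolding * by (cases k; simp)+
qed

lemma inst_tm_inj:
  assumes "param_terms \<nu>"
  shows "inst_tm l \<nu> t = inst_tm l \<nu> u \<Longrightarrow> t = u"
proof (induction t arbitrary: u)
  note neq = param_terms_neq[OF assms] param_terms_neq[OF assms, symmetric]
  have inj: "inj \<nu>" using assms by (simp add: param_terms_def)
  {
    case (DVar i)
    show ?case using DVar inj by (cases u) (simp_all add: neq inj_eq)
  next
    case DZero
    show ?case using DZero by (cases u) (simp_all add: neq)
  next
    case DOne
    show ?case using DOne by (cases u) (simp_all add: neq)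
  next
    case (DAdd t1 t2)
    show ?case using DAdd.prems by (cases u) (auto simp: neq dest: DAdd.IH)
  next
    case (DMul t1 t2)
    show ?case using DMul.prems by (cases u) (auto simp: neq dest: DMul.IH)
  next
    case (DExp t)
    show ?case using DExp.prems by (cases u) (auto simp: neq dest: DExp.IH)
  }
qed

lemma inst_inj:
  "param_terms \<nu> \<Longrightarrow> param_terms \<sigma> \<Longrightarrow> inst l \<nu> \<sigma> \<phi> = inst l \<nu> \<sigma> \<psi> \<Longrightarrow> \<phi> = \<psi>"
proof (induction \<phi> arbitrary: \<nu> \<sigma> \<psi>)
  case (DEq t u) then show ?case by (cases \<psi>) (auto dest: inst_tm_inj)
next
  case (DLt t u) then show ?case by (cases \<psi>) (auto dest: inst_tm_inj)
next
  case (DMem t j) then show ?case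
    by (cases \<psi>) (auto dest: inst_tm_inj simp: param_terms_def[of \<sigma>] inj_def)
next
  case (DAll t \<phi>)
  have p: "param_terms (bind l \<nu>)" "param_terms (\<lambda>j. lift_tm (Num l) (\<sigma> j))"
    using DAll.prems param_terms_bind param_terms_lift by blast+
  show ?case using DAll.prems(3)
    by (cases \<psi>) (auto dest: DAll.IH[OF p] inst_tm_inj[OF DAll.prems(1)])
next
  case (DEx t \<phi>)
  have p: "param_terms (bind l \<nu>)" "param_terms (\<lambda>j. lift_tm (Num l) (\<sigma> j))"
    using DEx.prems param_terms_bind param_terms_lift by blast+
  show ?case using DEx.prems(3)
    by (cases \<psi>) (auto dest: DEx.IH[OF p] inst_tm_inj[OF DEx.prems(1)])
next
  case (DNeg \<phi>)
  show ?case using DNeg.prems(3) by (cases \<psi>) (auto dest: DNeg.IH[OF DNeg.prems(1,2)])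
next
  case (DConj \<phi>1 \<phi>2)
  show ?case using DConj.prems(3)
    by (cases \<psi>) (auto dest: DConj.IH(1)[OF DConj.prems(1,2)] DConj.IH(2)[OF DConj.prems(1,2)])
next
  case (DDisj \<phi>1 \<phi>2)
  show ?case using DDisj.prems(3)
    by (cases \<psi>) (auto dest: DDisj.IH(1)[OF DDisj.prems(1,2)] DDisj.IH(2)[OF DDisj.prems(1,2)])
next
  case (DImp \<phi>1 \<phi>2)
  show ?case using DImp.prems(3)
    by (cases \<psi>) (auto dest: DImp.IH(1)[OF DImp.prems(1,2)] DImp.IH(2)[OF DImp.prems(1,2)])
qed

lemma app_inj:
  assumes "app l (LN, binders l) (LN, 0) [nv l 0] \<phi> = app l (LN, binders l) (LN, 0) [nv l 0] \<psi>"
  shows "\<phi> = \<psi>"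
proof -
  let ?\<nu> = "\<lambda>i. if i < length [nv l 0] then [nv l 0] ! i
              else embed LN l (nv LN (i - length [nv l 0] + binders l))"
  let ?\<sigma> = "\<lambda>j. embed LN l (sv LN (j + 0))"
  have eq: "?\<nu> i = (if i = 0 then (Up ^^ 0) (nv l 0) else (Up ^^ rank l) (nv LN (i - 1 + binders l)))" for i
    by (simp add: embed_def)
  have zero: "(Up ^^ 0) (nv l 0) \<noteq> (Up ^^ rank l) (nv LN (i + binders l))" for i
    unfolding funpow_Up_Var_eq by (auto simp: binders_def)
  have "inj ?\<nu>"
  proof (rule injI)
    fix i j assume ij: "?\<nu> i = ?\<nu> j"
    show "i = j"
    proof (cases "i = 0 \<or> j = 0")
      case True
      then show ?thesis using ij zero[of "i - 1"] zero[of "j - 1"] unfolding eq by metis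
    next
      case False
      then have "(Up ^^ rank l) (nv LN (i - 1 + binders l)) = (Up ^^ rank l) (nv LN (j - 1 + binders l))"
        using ij unfolding eq by metis
      then show ?thesis using False unfolding funpow_Up_Var_eq by auto
    qed
  qed
  moreover have "\<exists>k s j. ?\<nu> i = (Up ^^ k) (Var s j)" for i
    unfolding eq by metis
  ultimately have "param_terms ?\<nu>" unfolding param_terms_def by blast
  moreover have "param_terms ?\<sigma>"
    unfolding param_terms_def inj_def embed_def by (auto simp: funpow_Up_Var_eq)
  ultimately show ?thesis using assms inst_inj by simp
qed

lemma inj_AllQ: "inj (AllQ l)"
  unfolding inj_def AllQ_def by (auto dest!: app_inj simp del: app.simps)

lemma inj_ExQ: "inj (ExQ l)"
  unfolding inj_def ExQ_def by (auto dest!: app_inj simp del: app.simps)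

lemma inst_not_Q: "inst l \<nu> \<sigma> \<phi> \<noteq> Forall s A" "inst l \<nu> \<sigma> \<phi> \<noteq> Exists s A"
  by (cases \<phi>; simp)+

lemma push_neg_inst: "push_neg (inst l \<nu> \<sigma> \<phi>) = Neg (inst l \<nu> \<sigma> \<phi>)"
  by (cases \<phi>) auto

lemma push_neg_Q:
  "push_neg (ExQ l \<phi>) = AllQ l (DNeg \<phi>)" "push_neg (AllQ l \<phi>) = ExQ l (DNeg \<phi>)"
  by (simp_all add: ExQ_def AllQ_def push_neg_inst)

lemma nf_Q: "nf (ExQ l \<phi>) = ExQ l \<phi>" "nf (AllQ l \<phi>) = AllQ l \<phi>"
  by (simp_all add: ExQ_def AllQ_def)

lemma transferred_simps:
  "transferred (AllQ LN \<phi>) = Some (AllQ LStar \<phi>)"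
  "transferred (ExQ LStar \<phi>) = Some (ExQ LN1 \<phi>)"
  "transferred (ExQ LN \<phi>) = None"
  "transferred (ExQ LN1 \<phi>) = None"
  "transferred (AllQ LStar \<phi>) = None"
  "transferred falsum = None"
  by (auto simp: transferred_def inj_AllQ inj_ExQ)
     (auto simp: ExQ_def AllQ_def AllExN_def ExAllStar_def falsum_def inst_not_Q)

lemma hyper_neg_form:
  shows "nf (hyper_neg (ExQ LN \<phi>)) = AllQ LN (DNeg \<phi>)"
    and "inT (hyper_neg (ExQ LN \<phi>)) = Imp (AllQ LN (DNeg \<phi>)) (AllQ LStar (DNeg \<phi>))"
    and "nf (hyper_neg (hyper_neg (ExQ LN \<phi>))) = ExQ LStar (DNeg (DNeg \<phi>))"
    and "inT (hyper_neg (hyper_neg (ExQ LN \<phi>))) =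
           Imp (ExQ LStar (DNeg (DNeg \<phi>))) (ExQ LN1 (DNeg (DNeg \<phi>)))"
proof -
  have f: "nf falsum = falsum" "inT falsum = verum" "nf verum = verum"
    and c: "nf_conj falsum verum = falsum"
    by (simp_all add: inT_def inT_nf_def nf_conj_def transferred_simps)
       (simp_all add: falsum_def verum_def inT_nf_def transferred_simps[unfolded falsum_def])
  have p: "inT (ExQ LN \<phi>) = verum"
    by (simp add: inT_def inT_nf_def nf_Q transferred_simps)
  have np: "nf_conj (ExQ LN \<phi>) verum = ExQ LN \<phi>"
    by (simp add: nf_conj_def inT_nf_def transferred_simps)
  show 1: "nf (hyper_neg (ExQ LN \<phi>)) = AllQ LN (DNeg \<phi>)"
    by (simp add: hyper_neg_def hyper_imp_def p f c np nf_Q nf_imp_def push_neg_Q)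
  show 2: "inT (hyper_neg (ExQ LN \<phi>)) = Imp (AllQ LN (DNeg \<phi>)) (AllQ LStar (DNeg \<phi>))"
    by (simp add: inT_def 1 inT_nf_def transferred_simps)
  have nfl: "AllQ l \<psi> \<noteq> falsum" for l \<psi>
    by (simp add: AllQ_def falsum_def)
  have nc: "nf_conj (AllQ LN \<psi>) (Imp (AllQ LN \<psi>) (AllQ LStar \<psi>)) = AllQ LStar \<psi>" for \<psi>
    by (simp add: nf_conj_def inT_nf_def transferred_simps)
  have e: "hyper_neg A = Imp (Conj A (inT A)) (Conj falsum verum)" for A
    by (simp add: hyper_neg_def hyper_imp_def f)
  show 3: "nf (hyper_neg (hyper_neg (ExQ LN \<phi>))) = ExQ LStar (DNeg (DNeg \<phi>))"
    by (subst e) (simp add: 1 2 f c nf_Q nc nf_imp_def nfl push_neg_Q)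
  show "inT (hyper_neg (hyper_neg (ExQ LN \<phi>))) =
           Imp (ExQ LStar (DNeg (DNeg \<phi>))) (ExQ LN1 (DNeg (DNeg \<phi>)))"
    by (simp add: inT_def 3 inT_nf_def transferred_simps)
qed

end

theory Submission
  imports Defs "HOL-Library.Countable"
begin

text \<open>
  For \<open>P = (\<exists>n \<in> N) \<phi>(n)\<close> the formula \<open>\<sim>\<sim>P \<Rrightarrow> P\<close> says that \<open>\<phi>\<close> has a standard witness
  if it has a 1-finite and a nonstandard one, which is immediate from \<open>\<Pi>\<^sub>1\<close>-transfer to level 1.
  Positivity of a real is a \<open>\<Sigma>\<^sub>1\<close> formula, so MPR is a special case of MP.  To get transfer from
  MPR, suppose \<open>\<phi>(n)\<close> for all standard \<open>n\<close>, but \<open>\<not> \<phi>(c)\<close> for a 1-finite \<open>c\<close>.  Let \<open>X\<close> consist of the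
  codes \<open>(n, 0)\<close> for all \<open>n\<close> and \<open>(n, 2)\<close> for all \<open>n\<close> with \<open>\<not> \<phi>(n)\<close>.  Then \<open>X\<close> codes the real 0, while
  the transfer rule, applied to the description of \<open>X\<close>, shows that the image of \<open>X\<close> at level 1
  contains \<open>(c, 2)\<close>; so \<open>\<sim>\<sim>(X > 0)\<close> holds together with its membership in T, and MPR yields \<open>X > 0\<close>.

  Derivability is reduced to membership in all maximal consistent theories with witnessing
  terms; there the connectives and quantifiers have their Tarskian meaning, so that derivations
  in NSA become ordinary arguments about terms.
\<close>


section \<open>Substitution\<close>

text \<open>Environment extension for evaluating the body of a quantifier: by
  \<open>subst0_under\<close>, instantiating a binder after a substitution \<open>\<theta>\<close>
  is the single substitution \<open>push s t \<theta>\<close>, so no lifting appears in the truth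
  conditions later on.\<close>

definition push :: "sort \<Rightarrow> tm \<Rightarrow> (sort \<Rightarrow> nat \<Rightarrow> tm) \<Rightarrow> sort \<Rightarrow> nat \<Rightarrow> tm" where
  "push s t \<theta> = (\<lambda>s' i. if s' = s then case_nat t (\<theta> s) i else \<theta> s' i)"

lemma subst_tm_comp: "subst_tm \<theta> (subst_tm \<rho> t) = subst_tm (\<lambda>s i. subst_tm \<theta> (\<rho> s i)) t"
  by (induction t) simp_all

lemma subst_tm_Var [simp]: "subst_tm Var t = t"
  by (induction t) (simp_all add: map_idI)

lemma subst_tm_under_lift: "subst_tm (under s \<theta>) (lift_tm s t) = lift_tm s (subst_tm \<theta> t)"
  unfolding lift_tm_def subst_tm_comp
  by (rule arg_cong[where f = "\<lambda>\<rho>. subst_tm \<rho> t"])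
    (auto simp: shift_def under_def lift_tm_def fun_eq_iff)

lemma subst_tm_push_lift [simp]: "subst_tm (push s u \<theta>) (lift_tm s t) = subst_tm \<theta> t"
  unfolding lift_tm_def subst_tm_comp
  by (rule arg_cong[where f = "\<lambda>\<rho>. subst_tm \<rho> t"]) (auto simp: shift_def push_def fun_eq_iff)

lemma under_comp:
  "(\<lambda>s' i. subst_tm (under s \<theta>) (under s \<rho> s' i)) = under s (\<lambda>s' i. subst_tm \<theta> (\<rho> s' i))"
  by (intro ext) (auto simp: under_def[of s \<rho>] subst_tm_under_lift split: nat.split, auto simp: under_def)

lemma push_under:
  "(\<lambda>s' i. subst_tm (push s t \<theta>) (under s \<rho> s' i)) = push s t (\<lambda>s' i. subst_tm \<theta> (\<rho> s' i))"
  by (intro ext) (auto simp: under_def split: nat.split, auto simp: push_def)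

lemma under_Var [simp]: "under s Var = Var"
  by (intro ext) (auto simp: under_def lift_tm_def shift_def split: nat.split)

lemma subst_comp: "subst \<theta> (subst \<rho> A) = subst (\<lambda>s i. subst_tm \<theta> (\<rho> s i)) A"
  by (induction A arbitrary: \<theta> \<rho>) (simp_all add: subst_tm_comp under_comp)

lemma subst_Var [simp]: "subst Var A = A"
  by (induction A) simp_all

lemma subst0_eq: "subst0 s t A = subst (push s t Var) A"
  unfolding subst0_def by (rule arg_cong[where f = "\<lambda>\<rho>. subst \<rho> A"])
    (auto simp: push_def fun_eq_iff split: nat.split)

lemma subst0_under: "subst0 s t (subst (under s \<theta>) A) = subst (push s t \<theta>) A"
  by (simp add: subst0_eq subst_comp push_under)

lemma subst0_lift_tm: "subst_tm (push s t Var) (lift_tm s u) = u"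
  by simp

section \<open>Dependence of substitution on finitely many variables\<close>

primrec var_bound_tm :: "tm \<Rightarrow> nat" where
  "var_bound_tm (Var s i) = Suc i"
| "var_bound_tm (ZeroT l) = 0"
| "var_bound_tm (OneT l) = 0"
| "var_bound_tm (Add t u) = max (var_bound_tm t) (var_bound_tm u)"
| "var_bound_tm (Mul t u) = max (var_bound_tm t) (var_bound_tm u)"
| "var_bound_tm (Exp t) = var_bound_tm t"
| "var_bound_tm (Up t) = var_bound_tm t"
| "var_bound_tm (Cmp \<psi> ts Ss) = sum_list (map var_bound_tm ts) + sum_list (map var_bound_tm Ss)"

text \<open>A deliberately crude bound on the free indices: all sorts share it and binders do not
  lower it. An index \<open>Suc i\<close> below a binder reads the outer substitution at
  \<open>i\<close>, so the same bound carries over to the body.\<close>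

primrec var_bound :: "fm \<Rightarrow> nat" where
  "var_bound (Eq t u) = max (var_bound_tm t) (var_bound_tm u)"
| "var_bound (Lt t u) = max (var_bound_tm t) (var_bound_tm u)"
| "var_bound (Mem t u) = max (var_bound_tm t) (var_bound_tm u)"
| "var_bound (Neg A) = var_bound A"
| "var_bound (Conj A B) = max (var_bound A) (var_bound B)"
| "var_bound (Disj A B) = max (var_bound A) (var_bound B)"
| "var_bound (Imp A B) = max (var_bound A) (var_bound B)"
| "var_bound (BAll l t A) = max (var_bound_tm t) (var_bound A)"
| "var_bound (BEx l t A) = max (var_bound_tm t) (var_bound A)"
| "var_bound (Forall s A) = var_bound A"
| "var_bound (Exists s A) = var_bound A"

lemma subst_tm_cong:
  "(\<And>s i. i < var_bound_tm t \<Longrightarrow> \<theta> s i = \<rho> s i) \<Longrightarrow> subst_tm \<theta> t = subst_tm \<rho> t"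
proof (induction t)
  case (Cmp \<psi> ts Ss)
  have "var_bound_tm t \<le> var_bound_tm (Cmp \<psi> ts Ss)" if "t \<in> set ts \<or> t \<in> set Ss" for t
    using that member_le_sum_list[of "var_bound_tm t" "map var_bound_tm ts"]
      member_le_sum_list[of "var_bound_tm t" "map var_bound_tm Ss"] by fastforce
  then show ?case using Cmp by (simp add: less_le_trans)
qed simp_all

lemma under_cong:
  "(\<And>s i. i < n \<Longrightarrow> \<theta> s i = \<rho> s i) \<Longrightarrow> i < n \<Longrightarrow> under s \<theta> s' i = under s \<rho> s' i"
  by (auto simp: under_def split: nat.split)

lemma subst_cong:
  "(\<And>s i. i < var_bound A \<Longrightarrow> \<theta> s i = \<rho> s i) \<Longrightarrow> subst \<theta> A = subst \<rho> A"
proof (induction A arbitrary: \<theta> \<rho>)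
  case (Neg A)
  have "subst \<theta> A = subst \<rho> A" by (rule Neg; simp add: Neg.prems)
  then show ?case by simp
next
  case (Conj A B)
  have "subst \<theta> A = subst \<rho> A" "subst \<theta> B = subst \<rho> B" by (rule Conj; simp add: Conj.prems)+
  then show ?case by simp
next
  case (Disj A B)
  have "subst \<theta> A = subst \<rho> A" "subst \<theta> B = subst \<rho> B" by (rule Disj; simp add: Disj.prems)+
  then show ?case by simp
next
  case (Imp A B)
  have "subst \<theta> A = subst \<rho> A" "subst \<theta> B = subst \<rho> B" by (rule Imp; simp add: Imp.prems)+
  then show ?case by simp
next
  case (BAll l t A)
  have "subst (under (Num l) \<theta>) A = subst (under (Num l) \<rho>) A"
    by (rule BAll.IH, rule under_cong[where n = "var_bound A"]) (simp_all add: BAll.prems)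
  then show ?case using BAll.prems by (auto intro: subst_tm_cong)
next
  case (BEx l t A)
  have "subst (under (Num l) \<theta>) A = subst (under (Num l) \<rho>) A"
    by (rule BEx.IH, rule under_cong[where n = "var_bound A"]) (simp_all add: BEx.prems)
  then show ?case using BEx.prems by (auto intro: subst_tm_cong)
next
  case (Forall s A)
  have "subst (under s \<theta>) A = subst (under s \<rho>) A"
    by (rule Forall.IH, rule under_cong[where n = "var_bound A"]) (simp_all add: Forall.prems)
  then show ?case by simp
next
  case (Exists s A)
  have "subst (under s \<theta>) A = subst (under s \<rho>) A"
    by (rule Exists.IH, rule under_cong[where n = "var_bound A"]) (simp_all add: Exists.prems)
  then show ?case by simp
qed (auto intro: subst_tm_cong)

section \<open>Substitution and renaming in Delta-0 formulas\<close>

lemma subst_inst_tm: "subst_tm \<theta> (inst_tm l \<nu> t) = inst_tm l (\<lambda>i. subst_tm \<theta> (\<nu> i)) t"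
  by (induction t) simp_all

lemma subst_bind:
  "(\<lambda>i. subst_tm (under (Num l) \<theta>) (bind l \<nu> i)) = bind l (\<lambda>i. subst_tm \<theta> (\<nu> i))"
  by (rule ext) (auto simp: bind_def subst_tm_under_lift split: nat.split, simp add: under_def)

lemma subst_inst:
  "subst \<theta> (inst l \<nu> \<sigma> \<phi>) = inst l (\<lambda>i. subst_tm \<theta> (\<nu> i)) (\<lambda>j. subst_tm \<theta> (\<sigma> j)) \<phi>"
  by (induction \<phi> arbitrary: \<theta> \<nu> \<sigma>) (simp_all add: subst_inst_tm subst_bind subst_tm_under_lift)

lemma subst0_inst_bind:
  "subst0 (Num l) x (inst l (bind l \<nu>) (\<lambda>j. lift_tm (Num l) (\<sigma> j)) \<phi>) = inst l (case_nat x \<nu>) \<sigma> \<phi>"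
proof -
  have "(\<lambda>i. subst_tm (push (Num l) x Var) (bind l \<nu> i)) = case_nat x \<nu>"
    by (rule ext) (auto simp: bind_def split: nat.split, simp add: push_def)
  then show ?thesis by (simp add: subst0_eq subst_inst)
qed

text \<open>Only finitely many of the values of \<open>\<nu>\<close> and \<open>\<sigma>\<close> matter, since \<open>inst l \<nu> \<sigma> \<phi>\<close> is a
  substitution instance of \<open>inst l (nv l) (sv l) \<phi>\<close>.\<close>

lemma inst_cong_bounded:
  "\<exists>n. \<forall>\<nu> \<nu>' \<sigma> \<sigma>'. (\<forall>i<n. \<nu> i = \<nu>' i \<and> \<sigma> i = \<sigma>' i) \<longrightarrow> inst l \<nu> \<sigma> \<phi> = inst l \<nu>' \<sigma>' \<phi>"
proof -
  let ?\<theta> = "\<lambda>\<nu> \<sigma> s. if s = Num l then \<nu> else if s = Set l then \<sigma> else Var s"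
  have eq: "inst l \<nu> \<sigma> \<phi> = subst (?\<theta> \<nu> \<sigma>) (inst l (nv l) (sv l) \<phi>)" for \<nu> \<sigma>
    by (simp add: subst_inst)
  have "inst l \<nu> \<sigma> \<phi> = inst l \<nu>' \<sigma>' \<phi>"
    if "\<forall>i<var_bound (inst l (nv l) (sv l) \<phi>). \<nu> i = \<nu>' i \<and> \<sigma> i = \<sigma>' i" for \<nu> \<nu>' \<sigma> \<sigma>'
    unfolding eq[of \<nu>] eq[of \<nu>'] by (rule subst_cong) (simp add: that)
  then show ?thesis by blast
qed

primrec ren_tm :: "(nat \<Rightarrow> nat) \<Rightarrow> dtm \<Rightarrow> dtm" where
  "ren_tm f (DVar i) = DVar (f i)"
| "ren_tm f DZero = DZero"
| "ren_tm f DOne = DOne"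
| "ren_tm f (DAdd t u) = DAdd (ren_tm f t) (ren_tm f u)"
| "ren_tm f (DMul t u) = DMul (ren_tm f t) (ren_tm f u)"
| "ren_tm f (DExp t) = DExp (ren_tm f t)"

text \<open>Renaming places a given Delta-0 formula inside a larger one whose environment holds
  additional variables; by \<open>inst_ren\<close> it amounts to composing the environments with
  \<open>f\<close> and \<open>g\<close>. Set variables are never bound, hence only \<open>f\<close>
  is adjusted under a quantifier.\<close>

primrec ren :: "(nat \<Rightarrow> nat) \<Rightarrow> (nat \<Rightarrow> nat) \<Rightarrow> dfm \<Rightarrow> dfm" where
  "ren f g (DEq t u) = DEq (ren_tm f t) (ren_tm f u)"
| "ren f g (DLt t u) = DLt (ren_tm f t) (ren_tm f u)"
| "ren f g (DMem t j) = DMem (ren_tm f t) (g j)"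
| "ren f g (DNeg \<phi>) = DNeg (ren f g \<phi>)"
| "ren f g (DConj \<phi> \<psi>) = DConj (ren f g \<phi>) (ren f g \<psi>)"
| "ren f g (DDisj \<phi> \<psi>) = DDisj (ren f g \<phi>) (ren f g \<psi>)"
| "ren f g (DImp \<phi> \<psi>) = DImp (ren f g \<phi>) (ren f g \<psi>)"
| "ren f g (DAll t \<phi>) = DAll (ren_tm f t) (ren (case_nat 0 (\<lambda>i. Suc (f i))) g \<phi>)"
| "ren f g (DEx t \<phi>) = DEx (ren_tm f t) (ren (case_nat 0 (\<lambda>i. Suc (f i))) g \<phi>)"

lemma inst_tm_ren: "inst_tm l \<nu> (ren_tm f t) = inst_tm l (\<lambda>i. \<nu> (f i)) t"
  by (induction t) simp_all

lemma bind_ren: "(\<lambda>i. bind l \<nu> (case_nat 0 (\<lambda>i. Suc (f i)) i)) = bind l (\<lambda>i. \<nu> (f i))"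
  by (rule ext) (auto simp: bind_def split: nat.split)

lemma inst_ren: "inst l \<nu> \<sigma> (ren f g \<phi>) = inst l (\<lambda>i. \<nu> (f i)) (\<lambda>j. \<sigma> (g j)) \<phi>"
  by (induction \<phi> arbitrary: \<nu> \<sigma> f) (simp_all add: inst_tm_ren bind_ren)


section \<open>Admissible rules\<close>

lemma proves_mono: "proves H \<Gamma> A \<Longrightarrow> H \<subseteq> H' \<Longrightarrow> \<Gamma> \<subseteq> \<Gamma>' \<Longrightarrow> proves H' \<Gamma>' A"
proof (induction arbitrary: \<Gamma>' rule: proves.induct)
  case (Conj_I H \<Gamma> A B)
  show ?case by (rule proves.Conj_I[OF Conj_I.IH(1) Conj_I.IH(2)]) (use Conj_I in \<open>blast+\<close>)
next
  case (Conj_E1 H \<Gamma> A B)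
  show ?case by (rule proves.Conj_E1[OF Conj_E1.IH]) (use Conj_E1 in \<open>blast+\<close>)
next
  case (Conj_E2 H \<Gamma> A B)
  show ?case by (rule proves.Conj_E2[OF Conj_E2.IH]) (use Conj_E2 in \<open>blast+\<close>)
next
  case (Disj_I1 H \<Gamma> A B)
  show ?case by (rule proves.Disj_I1[OF Disj_I1.IH]) (use Disj_I1 in \<open>blast+\<close>)
next
  case (Disj_I2 H \<Gamma> B A)
  show ?case by (rule proves.Disj_I2[OF Disj_I2.IH]) (use Disj_I2 in \<open>blast+\<close>)
next
  case (Disj_E H \<Gamma> A B C)
  show ?case by (rule proves.Disj_E[OF Disj_E.IH(1) Disj_E.IH(2) Disj_E.IH(3)]) (use Disj_E in \<open>blast+\<close>)
next
  case (Imp_I H A \<Gamma> B)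
  show ?case by (rule proves.Imp_I[OF Imp_I.IH]) (use Imp_I in \<open>blast+\<close>)
next
  case (Imp_E H \<Gamma> A B)
  show ?case by (rule proves.Imp_E[OF Imp_E.IH(1) Imp_E.IH(2)]) (use Imp_E in \<open>blast+\<close>)
next
  case (Neg_I H A \<Gamma> B)
  show ?case by (rule proves.Neg_I[OF Neg_I.IH(1) Neg_I.IH(2)]) (use Neg_I in \<open>blast+\<close>)
next
  case (Classical H A \<Gamma> B)
  show ?case by (rule proves.Classical[OF Classical.IH(1) Classical.IH(2)]) (use Classical in \<open>blast+\<close>)
next
  case (Forall_I H s \<Gamma> A)
  show ?case by (rule proves.Forall_I[OF Forall_I.IH]) (use Forall_I in \<open>blast+\<close>)
next
  case (Forall_E H \<Gamma> s A t)
  show ?case by (rule proves.Forall_E[OF Forall_E.IH]) (use Forall_E in \<open>blast+\<close>)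
next
  case (Exists_I H \<Gamma> s t A)
  show ?case by (rule proves.Exists_I[OF Exists_I.IH]) (use Exists_I in \<open>blast+\<close>)
next
  case (Exists_E H \<Gamma> s A B)
  show ?case by (rule proves.Exists_E[OF Exists_E.IH(1) Exists_E.IH(2)]) (use Exists_E in \<open>blast+\<close>)
next
  case (Eq_subst H \<Gamma> t u l A)
  show ?case by (rule proves.Eq_subst[OF Eq_subst.IH(1) Eq_subst.IH(2)]) (use Eq_subst in \<open>blast+\<close>)
next
  \<comment> \<open>The premise of this rule belongs to NSA proper without assumptions, so enlarging
    \<open>H\<close> and \<open>\<Gamma>\<close> leaves it alone.\<close>
  case (Transfer_rule \<theta> \<phi>)
  show ?case by (rule proves.Transfer_rule[OF Transfer_rule.hyps(1,2)])
qed (auto intro: proves.Assumption proves.NSA_axiom proves.Extra_axiom proves.Eq_refl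
    proves.Bounded_all proves.Bounded_ex)

lemma proves_weaken: "proves H \<Gamma> A \<Longrightarrow> \<Gamma> \<subseteq> \<Gamma>' \<Longrightarrow> proves H \<Gamma>' A"
  by (rule proves_mono) auto

text \<open>Every use of an extra axiom is replaced by its derivation, which starts from no
  assumptions and can therefore be weakened into any context, also one lifted below quantifiers.
  This is what composes implications between principles.\<close>

lemma proves_cut_axioms:
  "proves H' \<Gamma> B \<Longrightarrow> (\<And>A. A \<in> H' \<Longrightarrow> proves H {} A) \<Longrightarrow> proves H \<Gamma> B"
proof (induction rule: proves.induct)
  case (Extra_axiom A H' \<Gamma>) then show ?case using proves_weaken by blast
next
  case (Conj_I H \<Gamma> A B)
  show ?case by (rule proves.Conj_I[OF Conj_I.IH(1) Conj_I.IH(2)]) (use Conj_I in \<open>blast+\<close>)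
next
  case (Conj_E1 H \<Gamma> A B)
  show ?case by (rule proves.Conj_E1[OF Conj_E1.IH]) (use Conj_E1 in \<open>blast+\<close>)
next
  case (Conj_E2 H \<Gamma> A B)
  show ?case by (rule proves.Conj_E2[OF Conj_E2.IH]) (use Conj_E2 in \<open>blast+\<close>)
next
  case (Disj_I1 H \<Gamma> A B)
  show ?case by (rule proves.Disj_I1[OF Disj_I1.IH]) (use Disj_I1 in \<open>blast+\<close>)
next
  case (Disj_I2 H \<Gamma> B A)
  show ?case by (rule proves.Disj_I2[OF Disj_I2.IH]) (use Disj_I2 in \<open>blast+\<close>)
next
  case (Disj_E H \<Gamma> A B C)
  show ?case by (rule proves.Disj_E[OF Disj_E.IH(1) Disj_E.IH(2) Disj_E.IH(3)]) (use Disj_E in \<open>blast+\<close>)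
next
  case (Imp_I H A \<Gamma> B)
  show ?case by (rule proves.Imp_I[OF Imp_I.IH]) (use Imp_I in \<open>blast+\<close>)
next
  case (Imp_E H \<Gamma> A B)
  show ?case by (rule proves.Imp_E[OF Imp_E.IH(1) Imp_E.IH(2)]) (use Imp_E in \<open>blast+\<close>)
next
  case (Neg_I H A \<Gamma> B)
  show ?case by (rule proves.Neg_I[OF Neg_I.IH(1) Neg_I.IH(2)]) (use Neg_I in \<open>blast+\<close>)
next
  case (Classical H A \<Gamma> B)
  show ?case by (rule proves.Classical[OF Classical.IH(1) Classical.IH(2)]) (use Classical in \<open>blast+\<close>)
next
  case (Forall_I H s \<Gamma> A)
  show ?case by (rule proves.Forall_I[OF Forall_I.IH]) (use Forall_I in \<open>blast+\<close>)
next
  case (Forall_E H \<Gamma> s A t)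
  show ?case by (rule proves.Forall_E[OF Forall_E.IH]) (use Forall_E in \<open>blast+\<close>)
next
  case (Exists_I H \<Gamma> s t A)
  show ?case by (rule proves.Exists_I[OF Exists_I.IH]) (use Exists_I in \<open>blast+\<close>)
next
  case (Exists_E H \<Gamma> s A B)
  show ?case by (rule proves.Exists_E[OF Exists_E.IH(1) Exists_E.IH(2)]) (use Exists_E in \<open>blast+\<close>)
next
  case (Eq_subst H \<Gamma> t u l A)
  show ?case by (rule proves.Eq_subst[OF Eq_subst.IH(1) Eq_subst.IH(2)]) (use Eq_subst in \<open>blast+\<close>)
next
  case (Transfer_rule \<theta> \<phi>)
  show ?case by (rule proves.Transfer_rule[OF Transfer_rule.hyps(1,2)])
qed (auto intro: proves.Assumption proves.NSA_axiom proves.Eq_refl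
    proves.Bounded_all proves.Bounded_ex)

section \<open>Closure of provability under substitution\<close>

definition wf_subst :: "(sort \<Rightarrow> nat \<Rightarrow> tm) \<Rightarrow> bool" where
  "wf_subst \<theta> \<longleftrightarrow> (\<forall>s i. has_sort (\<theta> s i) s)"

lemma wf_subst_Var [simp]: "wf_subst Var"
  by (simp add: wf_subst_def has_sort.intros)

lemma wf_subst_push [simp]: "wf_subst \<theta> \<Longrightarrow> has_sort t s \<Longrightarrow> wf_subst (push s t \<theta>)"
  by (auto simp: wf_subst_def push_def split: nat.split)

lemma proves_foldr_Forall: "proves H {} A \<Longrightarrow> proves H {} (foldr Forall ss A)"
  by (induction ss) (simp_all add: proves.Forall_I)

text \<open>\<open>n s\<close> counts the binders of sort \<open>s\<close> already crossed, on whose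
  indices \<open>\<theta>\<close> is the identity. Each quantifier passed moves one unit from the
  prefix to \<open>n\<close>; at the matrix every index that occurs lies below
  \<open>n\<close>.\<close>

lemma subst_closed:
  assumes "\<And>s i. i < n s \<Longrightarrow> \<theta> s i = Var s i"
    and "\<And>s. var_bound A \<le> n s + count_list ss s"
  shows "subst \<theta> (foldr Forall ss A) = foldr Forall ss A"
  using assms
proof (induction ss arbitrary: \<theta> n)
  case Nil
  then have "subst \<theta> A = subst Var A" by (intro subst_cong) (simp add: less_le_trans)
  then show ?case by simp
next
  case (Cons r ss)
  have "subst (under r \<theta>) (foldr Forall ss A) = foldr Forall ss A"
  proof (rule Cons.IH[where n = "n(r := Suc (n r))"])
    show "under r \<theta> s i = Var s i" if "i < (n(r := Suc (n r))) s" for s i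
      using that Cons.prems(1)
      by (auto simp: under_def lift_tm_def shift_def split: nat.split if_splits)
    show "var_bound A \<le> (n(r := Suc (n r))) s + count_list ss s" for s
      using Cons.prems(2)[of s] by (auto split: if_splits)
  qed
  then show ?case by simp
qed

text \<open>The prefix is instantiated from the outside. Below the quantifiers \<open>ss\<close>
  that remain, the outermost binder of sort \<open>r\<close> has index
  \<open>count_list ss r\<close>, whence the term chosen for it and the offset in
  \<open>\<rho>\<close>.\<close>

lemma proves_Forall_instance:
  "proves H \<Gamma> (subst \<rho> (foldr Forall ss A)) \<Longrightarrow> wf_subst \<theta> \<Longrightarrow>
    (\<And>s i. \<rho> s i = \<theta> s (i + count_list ss s)) \<Longrightarrow> proves H \<Gamma> (subst \<theta> A)"
proof (induction ss arbitrary: \<rho>)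
  case Nil
  then have "\<rho> = \<theta>" by (simp add: fun_eq_iff)
  then show ?case using Nil by simp
next
  case (Cons r ss)
  let ?t = "\<theta> r (count_list ss r)"
  have "proves H \<Gamma> (subst0 r ?t (subst (under r \<rho>) (foldr Forall ss A)))"
    by (rule proves.Forall_E) (use Cons.prems(1,2) in \<open>simp_all add: wf_subst_def\<close>)
  then show ?case
    unfolding subst0_under using Cons.prems(2)
    by (rule Cons.IH) (use Cons.prems(3) in \<open>auto simp: push_def split: nat.split\<close>)
qed

lemma ex_count_list_ge: "\<exists>ss :: sort list. \<forall>s. n \<le> count_list ss s"
proof -
  have c: "count_list (xs @ ys) s = count_list xs s + count_list ys s" for xs ys and s :: sort
    by (induction xs) auto
  have r: "count_list (replicate n s') s = (if s = s' then n else 0)" for s s' :: sort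
    by (induction n) auto
  let ?ss = "replicate n (Num LN) @ replicate n (Num LN1) @ replicate n (Num LStar) @
    replicate n (Set LN) @ replicate n (Set LN1) @ replicate n (Set LStar)"
  have "n \<le> count_list ?ss s" for s
  proof (cases s)
    case (Num l) then show ?thesis by (cases l) (simp_all add: c r)
  next
    case (Set l) then show ?thesis by (cases l) (simp_all add: c r)
  qed
  then show ?thesis by blast
qed

text \<open>The axioms are not literally closed under substitution: one generalizes over all free
  variables and instantiates.\<close>

lemma proves_subst:
  assumes "proves H {} A" "wf_subst \<theta>"
  shows "proves H {} (subst \<theta> A)"
proof -
  obtain ss :: "sort list" where ss: "\<And>s. var_bound A \<le> count_list ss s"
    using ex_count_list_ge[of "var_bound A"] by blast
  \<comment> \<open>\<open>\<theta>\<close> with the values for the quantified indices cut off. The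
    generalized formula is closed, so \<open>?\<rho>\<close> does not change it but brings it into
    the form from which the instantiation starts.\<close>
  let ?\<rho> = "\<lambda>s i. \<theta> s (i + count_list ss s)"
  have "subst ?\<rho> (foldr Forall ss A) = foldr Forall ss A"
    by (rule subst_closed[where n = "\<lambda>_. 0"]) (simp_all add: ss)
  then have "proves H {} (subst ?\<rho> (foldr Forall ss A))"
    using proves_foldr_Forall[OF assms(1)] by simp
  then show ?thesis by (rule proves_Forall_instance) (use assms(2) in auto)
qed

text \<open>\<open>proves_subst\<close> speaks of derivations without assumptions, so the finitely
  many assumptions are first discharged into implications.\<close>

lemma proves_subst_context:
  assumes "finite \<Gamma>" "proves H \<Gamma> A" "wf_subst \<theta>"
  shows "proves H (subst \<theta> ` \<Gamma>) (subst \<theta> A)"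
  using assms(1,2)
proof (induction \<Gamma> arbitrary: A rule: finite_induct)
  case empty then show ?case using proves_subst[OF _ assms(3)] by simp
next
  case (insert B \<Gamma>)
  have "proves H (subst \<theta> ` \<Gamma>) (subst \<theta> (Imp B A))"
    by (rule insert.IH) (rule proves.Imp_I[OF insert.prems])
  then have "proves H (subst \<theta> ` insert B \<Gamma>) (Imp (subst \<theta> B) (subst \<theta> A))"
    using proves_weaken[of H "subst \<theta> ` \<Gamma>" _ "subst \<theta> ` insert B \<Gamma>"] by auto
  then show ?case by (rule proves.Imp_E) (simp add: proves.Assumption)
qed


section \<open>Henkin theories\<close>

lemma proves_verum: "proves H \<Gamma> verum"
  unfolding verum_def by (rule proves.Eq_refl) (rule has_sort.intros)

text \<open>The language has no constant for absurdity; as \<open>verum\<close> is provable, its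
  negation takes that role.\<close>

definition consistent :: "fm set \<Rightarrow> fm set \<Rightarrow> bool" where
  "consistent H \<Gamma> \<longleftrightarrow> \<not> proves H \<Gamma> (Neg verum)"

lemma not_consistent_insertD: "\<not> consistent H (insert A \<Gamma>) \<Longrightarrow> proves H \<Gamma> (Neg A)"
  unfolding consistent_def using proves.Neg_I[OF proves_verum] by blast

text \<open>A renaming turns the fresh variable \<open>Var s k\<close> into the bound variable of
  existential elimination, so a contradiction from the witness would already follow from the
  existential formula.\<close>

lemma consistent_witness:
  assumes fin: "finite \<Gamma>" and con: "consistent H \<Gamma>" and ex: "Exists s B \<in> \<Gamma>"
    and fresh: "\<And>A. A \<in> \<Gamma> \<Longrightarrow> var_bound A \<le> k"
  shows "consistent H (insert (subst0 s (Var s k) B) \<Gamma>)"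
proof (rule ccontr)
  let ?W = "subst0 s (Var s k) B"
  \<comment> \<open>Sends \<open>k\<close> to the new index 0 and moves all other indices of sort
    \<open>s\<close> up; on formulas with all indices below \<open>k\<close> it agrees with
    lifting.\<close>
  define \<theta> where "\<theta> = (\<lambda>s' i. if s' = s then if i = k then Var s 0 else Var s (Suc i) else Var s' i)"
  assume "\<not> consistent H (insert ?W \<Gamma>)"
  then have "proves H (insert ?W \<Gamma>) (Neg verum)" by (simp add: consistent_def)
  then have "proves H (subst \<theta> ` insert ?W \<Gamma>) (subst \<theta> (Neg verum))"
    by (rule proves_subst_context[rotated])
      (use fin in \<open>auto simp: \<theta>_def wf_subst_def has_sort.intros\<close>)
  moreover have "subst \<theta> A = lift s A" if "A \<in> \<Gamma>" for A
    unfolding lift_def by (rule subst_cong) (use fresh[OF that] in \<open>auto simp: \<theta>_def shift_def\<close>)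
  moreover have "subst \<theta> ?W = B"
  proof -
    have "subst \<theta> ?W = subst Var B"
      unfolding subst0_eq subst_comp
      by (rule subst_cong) (use fresh[OF ex] in \<open>auto simp: \<theta>_def push_def split: nat.split\<close>)
    then show ?thesis by simp
  qed
  ultimately have "proves H (insert B (lift s ` \<Gamma>)) (lift s (Neg verum))"
    by (simp add: verum_def lift_def)
  with con ex show False
    unfolding consistent_def using proves.Exists_E[OF proves.Assumption] by blast
qed

section \<open>Construction of maximal consistent theories with witnesses\<close>

instance level :: countable by countable_datatype
instance sort :: countable by countable_datatype
instance dtm :: countable by countable_datatype
instance dfm :: countable by countable_datatype
instance tm :: countable by countable_datatype
instance fm :: countable by countable_datatype

definition fresh_var :: "fm set \<Rightarrow> nat" where
  "fresh_var \<Gamma> = (SOME k. \<forall>A\<in>\<Gamma>. var_bound A \<le> k)"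

lemma fresh_var: "finite \<Gamma> \<Longrightarrow> A \<in> \<Gamma> \<Longrightarrow> var_bound A \<le> fresh_var \<Gamma>"
proof -
  assume fin: "finite \<Gamma>" and A: "A \<in> \<Gamma>"
  have "\<forall>A\<in>\<Gamma>. var_bound A \<le> Max (var_bound ` \<Gamma>)" using fin by simp
  then have "\<forall>A\<in>\<Gamma>. var_bound A \<le> fresh_var \<Gamma>" unfolding fresh_var_def by (rule someI)
  then show ?thesis using A by blast
qed

definition henkin_step :: "fm set \<Rightarrow> fm \<Rightarrow> fm set \<Rightarrow> fm set" where
  "henkin_step H A \<Gamma> =
    (if consistent H (insert A \<Gamma>)
     then insert A \<Gamma> \<union> {subst0 s (Var s (fresh_var (insert A \<Gamma>))) B | s B. A = Exists s B}
     else \<Gamma>)"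

primrec henkin_seq :: "fm set \<Rightarrow> fm set \<Rightarrow> nat \<Rightarrow> fm set" where
  "henkin_seq H \<Gamma> 0 = \<Gamma>"
| "henkin_seq H \<Gamma> (Suc n) = henkin_step H (from_nat n) (henkin_seq H \<Gamma> n)"

lemma henkin_step:
  assumes "finite \<Gamma>" "consistent H \<Gamma>"
  shows "finite (henkin_step H A \<Gamma>)" "consistent H (henkin_step H A \<Gamma>)" "\<Gamma> \<subseteq> henkin_step H A \<Gamma>"
proof -
  show "\<Gamma> \<subseteq> henkin_step H A \<Gamma>" by (auto simp: henkin_step_def)
  show "finite (henkin_step H A \<Gamma>)" "consistent H (henkin_step H A \<Gamma>)"
  proof (atomize (full), cases "\<exists>s B. A = Exists s B")
    case True
    then obtain s B where A: "A = Exists s B" by blast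
    have "{subst0 s (Var s (fresh_var (insert A \<Gamma>))) B | s B. A = Exists s B} =
      {subst0 s (Var s (fresh_var (insert A \<Gamma>))) B}" using A by auto
    then show "finite (henkin_step H A \<Gamma>) \<and> consistent H (henkin_step H A \<Gamma>)"
      using assms consistent_witness[of "insert A \<Gamma>" H s B] fresh_var[of "insert A \<Gamma>"] A
      by (auto simp: henkin_step_def)
  next
    case False
    then show "finite (henkin_step H A \<Gamma>) \<and> consistent H (henkin_step H A \<Gamma>)"
      using assms by (auto simp: henkin_step_def)
  qed
qed

text \<open>\<open>Neg_iff\<close> packs maximality and consistency together. Closure is asked for
  finite contexts, since each finite subset of a limit of stages lies in a single stage.\<close>

locale henkin =
  fixes H \<Delta> :: "fm set"
  assumes closed: "finite \<Gamma> \<Longrightarrow> \<Gamma> \<subseteq> \<Delta> \<Longrightarrow> proves H \<Gamma> A \<Longrightarrow> A \<in> \<Delta>"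
    and Neg_iff: "Neg A \<in> \<Delta> \<longleftrightarrow> A \<notin> \<Delta>"
    and witness: "Exists s A \<in> \<Delta> \<Longrightarrow> \<exists>t. has_sort t s \<and> subst0 s t A \<in> \<Delta>"

lemma henkin_extension:
  assumes "finite \<Gamma>" "consistent H \<Gamma>"
  obtains \<Delta> where "henkin H \<Delta>" "\<Gamma> \<subseteq> \<Delta>"
proof
  let ?S = "henkin_seq H \<Gamma>"
  let ?\<Delta> = "\<Union>n. ?S n"
  have S: "finite (?S n) \<and> consistent H (?S n)" for n
    by (induction n) (use assms henkin_step in auto)
  have mono: "?S m \<subseteq> ?S n" if "m \<le> n" for m n
    using that
  proof (induction rule: dec_induct)
    case (step n)
    then show ?case using henkin_step(3)[of "?S n" H "from_nat n"] S[of n] by auto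
  qed simp
  show "\<Gamma> \<subseteq> ?\<Delta>" using UN_upper[of 0 UNIV ?S] by simp
  \<comment> \<open>The stage containing \<open>F\<close> can be taken beyond any given
    \<open>m\<close>; for witnesses, the existential formula has to be found in a stage at or after
    its own turn.\<close>
  have bounded: "\<exists>n\<ge>m. F \<subseteq> ?S n" if "finite F" "F \<subseteq> ?\<Delta>" for F m
    using that
  proof (induction F rule: finite_induct)
    case (insert A F)
    then obtain n k where "n \<ge> m" "F \<subseteq> ?S n" "A \<in> ?S k" by auto
    then show ?case using mono[of n "max n k"] mono[of k "max n k"]
      by (intro exI[of _ "max n k"]) auto
  qed auto
  have con: "\<not> proves H F (Neg verum)" if F: "finite F" "F \<subseteq> ?\<Delta>" for F
    using bounded[OF F, of 0] S proves_weaken unfolding consistent_def by meson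
  \<comment> \<open>\<open>A\<close> is examined at stage \<open>to_nat A\<close>: either it is
    added, or its negation is already derivable there.\<close>
  have decided: "A \<in> ?\<Delta> \<or> (\<exists>n. proves H (?S n) (Neg A))" for A
  proof (cases "consistent H (insert A (?S (to_nat A)))")
    case True
    then have "A \<in> ?S (Suc (to_nat A))" by (simp add: henkin_step_def)
    then show ?thesis by blast
  next
    case False then show ?thesis using not_consistent_insertD by blast
  qed
  have closed: "A \<in> ?\<Delta>" if F: "finite F" "F \<subseteq> ?\<Delta>" "proves H F A" for F A
  proof (rule ccontr)
    assume "A \<notin> ?\<Delta>"
    then obtain n where n: "proves H (?S n) (Neg A)" using decided by blast
    have "proves H (F \<union> ?S n) (Neg verum)"
      by (rule proves.Neg_I[of _ _ _ A]; rule proves_weaken[OF F(3)] proves_weaken[OF n]; blast)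
    moreover have "finite (F \<union> ?S n)" "F \<union> ?S n \<subseteq> ?\<Delta>" using F S by auto
    ultimately show False using con by blast
  qed
  show "henkin H ?\<Delta>"
  proof
    fix A
    show "Neg A \<in> ?\<Delta> \<longleftrightarrow> A \<notin> ?\<Delta>"
    proof
      assume "Neg A \<in> ?\<Delta>"
      show "A \<notin> ?\<Delta>"
      proof
        assume "A \<in> ?\<Delta>"
        have "proves H {A, Neg A} (Neg verum)"
          by (rule proves.Neg_I[of _ _ _ A]; rule proves.Assumption; blast)
        then show False using con[of "{A, Neg A}"] \<open>A \<in> ?\<Delta>\<close> \<open>Neg A \<in> ?\<Delta>\<close> by blast
      qed
    next
      assume "A \<notin> ?\<Delta>"
      then obtain n where "proves H (?S n) (Neg A)" using decided by blast
      then show "Neg A \<in> ?\<Delta>" using closed[of "?S n"] S by blast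
    qed
  next
    fix s A
    assume ex: "Exists s A \<in> ?\<Delta>"
    let ?n = "to_nat (Exists s A)"
    obtain m where m: "m \<ge> ?n" "Exists s A \<in> ?S m"
      using bounded[of "{Exists s A}" ?n] ex by blast
    \<comment> \<open>The formula lies in the consistent stage \<open>?S m\<close>, which contains
      \<open>?S ?n\<close>; hence it was accepted at its turn, together with a witness.\<close>
    have "consistent H (insert (Exists s A) (?S ?n))"
      unfolding consistent_def
    proof
      assume "proves H (insert (Exists s A) (?S ?n)) (Neg verum)"
      then have "proves H (?S m) (Neg verum)"
        by (rule proves_weaken) (use m mono in auto)
      then show False using S by (simp add: consistent_def)
    qed
    then have "subst0 s (Var s (fresh_var (insert (Exists s A) (?S ?n)))) A \<in> ?S (Suc ?n)"
      by (auto simp: henkin_step_def)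
    then show "\<exists>t. has_sort t s \<and> subst0 s t A \<in> ?\<Delta>"
      using has_sort.intros(1) by blast
  qed (rule closed)
qed

text \<open>If \<open>A\<close> is unprovable, \<open>Neg A\<close> is consistent, and a Henkin
  theory around \<open>Neg A\<close> omits \<open>A\<close>. Provability thus becomes an argument
  about arbitrary Henkin theories.\<close>

lemma proves_if_henkin:
  assumes "\<And>\<Delta>. henkin H \<Delta> \<Longrightarrow> A \<in> \<Delta>"
  shows "proves H {} A"
proof (rule ccontr)
  assume not: "\<not> proves H {} A"
  have "consistent H {Neg A}"
    unfolding consistent_def
  proof
    assume "proves H {Neg A} (Neg verum)"
    then have "proves H {} A" by (rule proves.Classical[OF proves_verum])
    with not show False by blast
  qed
  then obtain \<Delta> where "henkin H \<Delta>" "{Neg A} \<subseteq> \<Delta>" using henkin_extension by blast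
  then show False using assms[of \<Delta>] henkin.Neg_iff by blast
qed

section \<open>Truth conditions in a Henkin theory\<close>

lemma subst_tm_embed [simp]: "subst_tm \<theta> (embed l l' t) = embed l l' (subst_tm \<theta> t)"
proof -
  have "subst_tm \<theta> ((Up ^^ k) t) = (Up ^^ k) (subst_tm \<theta> t)" for k by (induction k) simp_all
  then show ?thesis by (simp add: embed_def)
qed

lemma embed_simps [simp]:
  "embed l l t = t" "embed LN LN1 t = Up t" "embed LN1 LStar t = Up t" "embed LN LStar t = Up (Up t)"
  by (simp_all add: embed_def eval_nat_numeral)

lemma has_sort_Up [simp]:
  "has_sort t (Num LN) \<Longrightarrow> has_sort (Up t) (Num LN1)"
  "has_sort t (Num LN1) \<Longrightarrow> has_sort (Up t) (Num LStar)"
  "has_sort t (Set LN) \<Longrightarrow> has_sort (Up t) (Set LN1)"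
  "has_sort t (Set LN1) \<Longrightarrow> has_sort (Up t) (Set LStar)"
  by (rule has_sort.intros(7,8), assumption, simp)+

lemma has_sort_simps [simp]:
  "has_sort (Var s i) s" "has_sort (ZeroT l) (Num l)" "has_sort (OneT l) (Num l)"
  "has_sort t (Num l) \<Longrightarrow> has_sort u (Num l) \<Longrightarrow> has_sort (Add t u) (Num l)"
  "has_sort t (Num l) \<Longrightarrow> has_sort u (Num l) \<Longrightarrow> has_sort (Mul t u) (Num l)"
  "has_sort t (Num l) \<Longrightarrow> has_sort (Exp t) (Num l)"
  by (auto intro: has_sort.intros)

lemma has_sort_inst_tm: "(\<And>i. has_sort (\<nu> i) (Num l)) \<Longrightarrow> has_sort (inst_tm l \<nu> t) (Num l)"
  by (induction t) simp_all

definition subst_at :: "level \<Rightarrow> (nat \<Rightarrow> tm) \<Rightarrow> (nat \<Rightarrow> tm) \<Rightarrow> sort \<Rightarrow> nat \<Rightarrow> tm" where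
  "subst_at l \<nu> \<sigma> = (\<lambda>s. if s = Num l then \<nu> else if s = Set l then \<sigma> else Var s)"

lemma subst_at_simps [simp]: "subst_at l \<nu> \<sigma> (Num l) = \<nu>" "subst_at l \<nu> \<sigma> (Set l) = \<sigma>"
  by (simp_all add: subst_at_def)

lemma wf_subst_at:
  "(\<And>i. has_sort (\<nu> i) (Num l)) \<Longrightarrow> (\<And>j. has_sort (\<sigma> j) (Set l)) \<Longrightarrow> wf_subst (subst_at l \<nu> \<sigma>)"
  by (simp add: wf_subst_def subst_at_def)

context henkin
begin

lemma theorem_mem: "proves H {} A \<Longrightarrow> A \<in> \<Delta>"
  using closed[of "{}"] by simp

lemma axiom_mem: "A \<in> NSA_axioms \<Longrightarrow> wf_subst \<theta> \<Longrightarrow> subst \<theta> A \<in> \<Delta>"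
  by (intro theorem_mem proves_subst proves.NSA_axiom)

lemma extra_axiom_mem: "A \<in> H \<Longrightarrow> A \<in> \<Delta>"
  by (intro theorem_mem proves.Extra_axiom)

lemma verum_mem [simp]: "verum \<in> \<Delta>"
  by (intro theorem_mem proves_verum)

lemma closed1: "proves H {A} B \<Longrightarrow> A \<in> \<Delta> \<Longrightarrow> B \<in> \<Delta>"
  using closed[of "{A}" B] by simp

lemma Conj_iff: "Conj A B \<in> \<Delta> \<longleftrightarrow> A \<in> \<Delta> \<and> B \<in> \<Delta>"
proof
  have AB: "proves H {Conj A B} (Conj A B)" by (rule proves.Assumption) simp
  assume "Conj A B \<in> \<Delta>"
  then show "A \<in> \<Delta> \<and> B \<in> \<Delta>"
    using closed1[OF proves.Conj_E1[OF AB]] closed1[OF proves.Conj_E2[OF AB]] by simp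
next
  have "proves H {A, B} (Conj A B)"
    by (rule proves.Conj_I; rule proves.Assumption; simp)
  moreover assume "A \<in> \<Delta> \<and> B \<in> \<Delta>"
  ultimately show "Conj A B \<in> \<Delta>" using closed[of "{A, B}" "Conj A B"] by simp
qed

lemma Imp_iff: "Imp A B \<in> \<Delta> \<longleftrightarrow> (A \<in> \<Delta> \<longrightarrow> B \<in> \<Delta>)"
proof
  have "proves H {Imp A B, A} B"
    by (rule proves.Imp_E[of _ _ A]; rule proves.Assumption; simp)
  moreover assume "Imp A B \<in> \<Delta>"
  ultimately show "A \<in> \<Delta> \<longrightarrow> B \<in> \<Delta>"
    using closed[of "{Imp A B, A}" B] by simp
next
  assume "A \<in> \<Delta> \<longrightarrow> B \<in> \<Delta>"
  then consider "B \<in> \<Delta>" | "Neg A \<in> \<Delta>" using Neg_iff by blast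
  then show "Imp A B \<in> \<Delta>"
  proof cases
    case 1
    have "proves H {B} (Imp A B)" by (rule proves.Imp_I, rule proves.Assumption) simp
    then show ?thesis using 1 by (rule closed1)
  next
    case 2
    have "proves H {Neg A} (Imp A B)"
      by (rule proves.Imp_I, rule proves.Classical[of _ _ _ A]; rule proves.Assumption; simp)
    then show ?thesis using 2 by (rule closed1)
  qed
qed

lemma Disj_iff: "Disj A B \<in> \<Delta> \<longleftrightarrow> A \<in> \<Delta> \<or> B \<in> \<Delta>"
proof
  assume D: "Disj A B \<in> \<Delta>"
  show "A \<in> \<Delta> \<or> B \<in> \<Delta>"
  proof (rule ccontr)
    assume "\<not> (A \<in> \<Delta> \<or> B \<in> \<Delta>)"
    then have n: "Neg A \<in> \<Delta>" "B \<notin> \<Delta>" using Neg_iff by auto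
    have "proves H {Disj A B, Neg A} B"
    proof (rule proves.Disj_E)
      show "proves H {Disj A B, Neg A} (Disj A B)" by (rule proves.Assumption) simp
      show "proves H (insert A {Disj A B, Neg A}) B"
        by (rule proves.Classical[of _ _ _ A]; rule proves.Assumption; simp)
      show "proves H (insert B {Disj A B, Neg A}) B" by (rule proves.Assumption) simp
    qed
    then show False using closed[of "{Disj A B, Neg A}" B] D n by auto
  qed
next
  have 1: "proves H {A} (Disj A B)" by (rule proves.Disj_I1, rule proves.Assumption) simp
  have 2: "proves H {B} (Disj A B)" by (rule proves.Disj_I2, rule proves.Assumption) simp
  assume "A \<in> \<Delta> \<or> B \<in> \<Delta>"
  then show "Disj A B \<in> \<Delta>" using closed1[OF 1] closed1[OF 2] by blast
qed

lemma Exists_iff: "Exists s A \<in> \<Delta> \<longleftrightarrow> (\<exists>t. has_sort t s \<and> subst0 s t A \<in> \<Delta>)"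
proof
  assume "\<exists>t. has_sort t s \<and> subst0 s t A \<in> \<Delta>"
  then obtain t where t: "has_sort t s" "subst0 s t A \<in> \<Delta>" by blast
  have "proves H {subst0 s t A} (Exists s A)"
    by (rule proves.Exists_I[OF _ t(1)], rule proves.Assumption) simp
  then show "Exists s A \<in> \<Delta>" using t(2) by (rule closed1)
qed (rule witness)

lemma Forall_iff: "Forall s A \<in> \<Delta> \<longleftrightarrow> (\<forall>t. has_sort t s \<longrightarrow> subst0 s t A \<in> \<Delta>)"
proof
  assume F: "Forall s A \<in> \<Delta>"
  have "proves H {Forall s A} (subst0 s t A)" if "has_sort t s" for t
    by (rule proves.Forall_E[OF _ that], rule proves.Assumption) simp
  then show "\<forall>t. has_sort t s \<longrightarrow> subst0 s t A \<in> \<Delta>" using closed1[OF _ F] by blast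
next
  assume all: "\<forall>t. has_sort t s \<longrightarrow> subst0 s t A \<in> \<Delta>"
  show "Forall s A \<in> \<Delta>"
  proof (rule ccontr)
    assume F: "Forall s A \<notin> \<Delta>"
    have NE: "Neg (Exists s (Neg A)) \<in> \<Delta>"
      using all by (auto simp: Neg_iff Exists_iff subst0_def)
    have "proves H {Neg (Exists s (Neg A))} (Forall s A)"
    proof (rule proves.Forall_I, rule proves.Classical)
      let ?\<Gamma> = "insert (Neg A) (lift s ` {Neg (Exists s (Neg A))})"
      let ?E = "Exists s (subst (under s (shift s)) (Neg A))"
      \<comment> \<open>Lifting under the binder and instantiating with its own variable restores
        the formula, which makes \<open>Var s 0\<close> a witness for the lifted existential
        formula.\<close>
      have "subst (push s (Var s 0) (shift s)) (Neg A) = subst Var (Neg A)"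
        by (rule arg_cong[where f = "\<lambda>\<rho>. subst \<rho> (Neg A)"])
          (auto simp: push_def shift_def fun_eq_iff split: nat.split)
      then have "subst0 s (Var s 0) (subst (under s (shift s)) (Neg A)) = Neg A"
        unfolding subst0_under by simp
      then show "proves H ?\<Gamma> ?E"
        by (intro proves.Exists_I[where t = "Var s 0"]) (simp_all add: proves.Assumption)
      show "proves H ?\<Gamma> (Neg ?E)" by (rule proves.Assumption) (simp add: lift_def)
    qed
    then show False using closed1[OF _ NE] F by blast
  qed
qed

lemma BAll_iff:
  assumes "has_sort t (Num l)"
  shows "BAll l t A \<in> \<Delta> \<longleftrightarrow>
    (\<forall>x. has_sort x (Num l) \<longrightarrow> Lt x t \<in> \<Delta> \<longrightarrow> subst0 (Num l) x A \<in> \<Delta>)"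
proof -
  have "BAll l t A \<in> \<Delta> \<longleftrightarrow> Forall (Num l) (Imp (Lt (nv l 0) (lift_tm (Num l) t)) A) \<in> \<Delta>"
    using theorem_mem[OF proves.Bounded_all[OF assms]] by (auto simp: Conj_iff Imp_iff)
  then show ?thesis by (simp add: Forall_iff subst0_eq Imp_iff) (simp add: push_def)
qed

lemma BEx_iff:
  assumes "has_sort t (Num l)"
  shows "BEx l t A \<in> \<Delta> \<longleftrightarrow>
    (\<exists>x. has_sort x (Num l) \<and> Lt x t \<in> \<Delta> \<and> subst0 (Num l) x A \<in> \<Delta>)"
proof -
  have "BEx l t A \<in> \<Delta> \<longleftrightarrow> Exists (Num l) (Conj (Lt (nv l 0) (lift_tm (Num l) t)) A) \<in> \<Delta>"
    using theorem_mem[OF proves.Bounded_ex[OF assms]] by (auto simp: Conj_iff Imp_iff)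
  then show ?thesis by (simp add: Exists_iff subst0_eq Conj_iff) (simp add: push_def)
qed

lemmas connective_iffs = Neg_iff Conj_iff Disj_iff Imp_iff

lemma subst_quantifier_iff:
  "subst \<theta> (Forall s A) \<in> \<Delta> \<longleftrightarrow> (\<forall>t. has_sort t s \<longrightarrow> subst (push s t \<theta>) A \<in> \<Delta>)"
  "subst \<theta> (Exists s A) \<in> \<Delta> \<longleftrightarrow> (\<exists>t. has_sort t s \<and> subst (push s t \<theta>) A \<in> \<Delta>)"
  by (simp_all add: Forall_iff Exists_iff subst0_under)

lemma inst_bounded_iff:
  assumes "\<And>i. has_sort (\<nu> i) (Num l)"
  shows "inst l \<nu> \<sigma> (DAll t \<phi>) \<in> \<Delta> \<longleftrightarrow> (\<forall>x. has_sort x (Num l) \<longrightarrow>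
      Lt x (inst_tm l \<nu> t) \<in> \<Delta> \<longrightarrow> inst l (case_nat x \<nu>) \<sigma> \<phi> \<in> \<Delta>)"
    and "inst l \<nu> \<sigma> (DEx t \<phi>) \<in> \<Delta> \<longleftrightarrow> (\<exists>x. has_sort x (Num l) \<and>
      Lt x (inst_tm l \<nu> t) \<in> \<Delta> \<and> inst l (case_nat x \<nu>) \<sigma> \<phi> \<in> \<Delta>)"
  by (simp_all add: BAll_iff BEx_iff has_sort_inst_tm assms subst0_inst_bind)

text \<open>The offset \<open>binders l\<close> accounts for the shared index space: only when
  \<open>l\<close> is \<open>LN\<close> does the quantified variable take an index away from the
  standard parameters. In either case the parameters receive \<open>\<theta>\<close>, and variable 0
  the pushed \<open>x\<close>.\<close>

lemma subst_app_quantified: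
  "subst (push (Num l) x \<theta>) (app l (LN, binders l) (LN, 0) [nv l 0] \<phi>) =
    inst l (case_nat x (\<lambda>i. embed LN l (\<theta> (Num LN) i))) (\<lambda>j. embed LN l (\<theta> (Set LN) j)) \<phi>"
proof -
  have "(\<lambda>i. subst_tm (push (Num l) x \<theta>) (if i < length [nv l 0] then [nv l 0] ! i
        else embed LN l (nv LN (i - length [nv l 0] + binders l)))) =
      case_nat x (\<lambda>i. embed LN l (\<theta> (Num LN) i))"
    by (rule ext) (auto simp: push_def binders_def split: nat.split)
  moreover have "(\<lambda>j. subst_tm (push (Num l) x \<theta>) (embed LN l (sv LN (j + 0)))) =
      (\<lambda>j. embed LN l (\<theta> (Set LN) j))"
    by (rule ext) (simp add: push_def)
  ultimately show ?thesis by (simp only: app.simps subst_inst)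
qed

lemma AllQ_iff:
  "subst \<theta> (AllQ l \<phi>) \<in> \<Delta> \<longleftrightarrow> (\<forall>x. has_sort x (Num l) \<longrightarrow>
    inst l (case_nat x (\<lambda>i. embed LN l (\<theta> (Num LN) i))) (\<lambda>j. embed LN l (\<theta> (Set LN) j)) \<phi> \<in> \<Delta>)"
  unfolding AllQ_def subst_quantifier_iff subst_app_quantified ..

lemma ExQ_iff:
  "subst \<theta> (ExQ l \<phi>) \<in> \<Delta> \<longleftrightarrow> (\<exists>x. has_sort x (Num l) \<and>
    inst l (case_nat x (\<lambda>i. embed LN l (\<theta> (Num LN) i))) (\<lambda>j. embed LN l (\<theta> (Set LN) j)) \<phi> \<in> \<Delta>)"
  unfolding ExQ_def subst_quantifier_iff subst_app_quantified ..

lemma ExQ_iff_not_AllQ: "subst \<theta> (ExQ l \<phi>) \<in> \<Delta> \<longleftrightarrow> subst \<theta> (AllQ l (DNeg \<phi>)) \<notin> \<Delta>"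
  by (simp add: ExQ_iff AllQ_iff Neg_iff)

lemma Delta0_TRANS_iff:
  assumes "rank l < rank l'" "\<And>i. has_sort (\<nu> i) (Num l)" "\<And>j. has_sort (\<sigma> j) (Set l)"
  shows "inst l \<nu> \<sigma> \<phi> \<in> \<Delta> \<longleftrightarrow>
    inst l' (\<lambda>i. embed l l' (\<nu> i)) (\<lambda>j. embed l l' (\<sigma> j)) \<phi> \<in> \<Delta>"
proof -
  have "subst (subst_at l \<nu> \<sigma>) (Delta0_TRANS l l' \<phi>) \<in> \<Delta>"
    by (rule axiom_mem) (use assms in \<open>simp_all add: NSA_axioms.intros wf_subst_at\<close>)
  then show ?thesis
    by (auto simp: Delta0_TRANS_def connective_iffs subst_inst)
qed

lemma transfer_mem:
  "proves {} {} (subst \<theta> (AllQ LN \<phi>)) \<Longrightarrow> wf_subst \<theta> \<Longrightarrow> subst \<theta> (AllQ LStar \<phi>) \<in> \<Delta>"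
  unfolding wf_subst_def by (intro theorem_mem proves.Transfer_rule)

lemma Cmp_iff:
  assumes "has_sort (Cmp \<psi> ts Ss) (Set LN)" "has_sort p (Num LN)"
  shows "Mem p (Cmp \<psi> ts Ss) \<in> \<Delta> \<longleftrightarrow>
    inst LN (case_nat p (\<lambda>i. if i < length ts then ts ! i else ZeroT LN))
      (\<lambda>j. if j < length Ss then Ss ! j else Cmp (DNeg (DEq DZero DZero)) [] []) \<psi> \<in> \<Delta>"
    (is "_ \<longleftrightarrow> inst LN (case_nat p ?\<nu>) ?\<sigma> \<psi> \<in> \<Delta>")
proof -
  let ?A = "Mem (nv LN 0) (lift_tm (Num LN) (Cmp \<psi> ts Ss))"
  let ?B = "inst LN (bind LN ?\<nu>) (\<lambda>j. lift_tm (Num LN) (?\<sigma> j)) \<psi>"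
  have "Cmp_axiom \<psi> ts Ss \<in> \<Delta>"
    by (intro theorem_mem proves.NSA_axiom NSA_axioms.intros assms)
  then have "subst0 (Num LN) p (Iff ?A ?B) \<in> \<Delta>"
    unfolding Cmp_axiom_def Forall_iff using assms(2) by blast
  moreover have "subst0 (Num LN) p ?A = Mem p (Cmp \<psi> ts Ss)"
    unfolding subst0_eq subst.simps subst0_lift_tm by (simp add: push_def)
  moreover have "subst0 (Num LN) p (Iff ?A ?B) =
      Iff (subst0 (Num LN) p ?A) (subst0 (Num LN) p ?B)"
    by (simp only: subst0_def subst.simps)
  ultimately show ?thesis
    unfolding subst0_inst_bind by (auto simp: connective_iffs)
qed

end

lemma push_same [simp]: "push s t \<theta> s = case_nat t (\<theta> s)"
  and push_other [simp]: "s' \<noteq> s \<Longrightarrow> push s t \<theta> s' = \<theta> s'"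
  by (simp_all add: push_def fun_eq_iff)


section \<open>Arithmetic of the standard numbers\<close>

abbreviation std_num :: "tm \<Rightarrow> bool" where
  "std_num t \<equiv> has_sort t (Num LN)"

text \<open>Padding with zero gives every index a well-sorted value, as the sort conditions on
  environments demand.\<close>

primrec list_env :: "tm list \<Rightarrow> nat \<Rightarrow> tm" where
  "list_env [] = (\<lambda>_. ZeroT LN)"
| "list_env (t # ts) = case_nat t (list_env ts)"

lemma std_num_case_nat [simp]: "std_num t \<Longrightarrow> (\<And>i. std_num (\<nu> i)) \<Longrightarrow> std_num (case_nat t \<nu> i)"
  by (cases i) simp_all

lemma std_num_list_env: "\<forall>t\<in>set ts. std_num t \<Longrightarrow> std_num (list_env ts i)"
  by (induction ts arbitrary: i) (auto intro: std_num_case_nat)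

context henkin
begin

lemma Eq_subst_mem:
  assumes "Eq t u \<in> \<Delta>" "subst0 (Num l) t A \<in> \<Delta>" "has_sort t (Num l)" "has_sort u (Num l)"
  shows "subst0 (Num l) u A \<in> \<Delta>"
proof -
  let ?\<Gamma> = "{Eq t u, subst0 (Num l) t A}"
  have "proves H ?\<Gamma> (subst0 (Num l) u A)"
    by (rule proves.Eq_subst[of _ _ t]) (use assms in \<open>auto intro: proves.Assumption\<close>)
  then show ?thesis using closed[of ?\<Gamma> "subst0 (Num l) u A"] assms by simp
qed

lemma subst0_atoms:
  "subst0 s t (Eq a b) = Eq (subst_tm (push s t Var) a) (subst_tm (push s t Var) b)"
  "subst0 s t (Lt a b) = Lt (subst_tm (push s t Var) a) (subst_tm (push s t Var) b)"
  "subst0 s t (Mem a b) = Mem (subst_tm (push s t Var) a) (subst_tm (push s t Var) b)"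
  "push s t Var s 0 = t"
  by (simp_all add: subst0_eq push_def)

lemma Eq_refl_mem: "std_num a \<Longrightarrow> Eq a a \<in> \<Delta>"
  by (intro theorem_mem proves.Eq_refl)

lemma Eq_sym_mem: "Eq a b \<in> \<Delta> \<Longrightarrow> std_num a \<Longrightarrow> std_num b \<Longrightarrow> Eq b a \<in> \<Delta>"
  using Eq_subst_mem[of a b LN "Eq (nv LN 0) (lift_tm (Num LN) a)"]
  by (simp add: subst0_atoms Eq_refl_mem)

lemma Eq_trans_mem:
  "Eq a b \<in> \<Delta> \<Longrightarrow> Eq b c \<in> \<Delta> \<Longrightarrow> std_num b \<Longrightarrow> std_num c \<Longrightarrow> Eq a c \<in> \<Delta>"
  using Eq_subst_mem[of b c LN "Eq (lift_tm (Num LN) a) (nv LN 0)"]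
  by (simp add: subst0_atoms)

text \<open>The standard part of the Henkin model: numbers are classes of provably equal terms.\<close>

definition val :: "tm \<Rightarrow> tm set" where
  "val a = {b. std_num b \<and> Eq a b \<in> \<Delta>}"

definition dom :: "tm set set" where
  "dom = val ` {a. std_num a}"

definition rep :: "tm set \<Rightarrow> tm" where
  "rep x = (SOME a. std_num a \<and> val a = x)"

definition plus :: "tm set \<Rightarrow> tm set \<Rightarrow> tm set" (infixl \<open>\<oplus>\<close> 65) where
  "x \<oplus> y = val (Add (rep x) (rep y))"

definition times :: "tm set \<Rightarrow> tm set \<Rightarrow> tm set" (infixl \<open>\<otimes>\<close> 70) where
  "x \<otimes> y = val (Mul (rep x) (rep y))"

definition power2 :: "tm set \<Rightarrow> tm set" where
  "power2 x = val (Exp (rep x))"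

definition less :: "tm set \<Rightarrow> tm set \<Rightarrow> bool" (infix \<open>\<prec>\<close> 50) where
  "x \<prec> y \<longleftrightarrow> Lt (rep x) (rep y) \<in> \<Delta>"

abbreviation zero (\<open>\<zero>\<close>) where "\<zero> \<equiv> val (ZeroT LN)"
abbreviation one (\<open>\<one>\<close>) where "\<one> \<equiv> val (OneT LN)"

lemma Eq_iff_val: "std_num a \<Longrightarrow> std_num b \<Longrightarrow> Eq a b \<in> \<Delta> \<longleftrightarrow> val a = val b"
  unfolding val_def using Eq_refl_mem Eq_sym_mem Eq_trans_mem by blast

lemma val_mem_dom [simp]: "std_num a \<Longrightarrow> val a \<in> dom"
  by (simp add: dom_def)

lemma rep: "x \<in> dom \<Longrightarrow> std_num (rep x)" "x \<in> dom \<Longrightarrow> val (rep x) = x"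
proof -
  assume "x \<in> dom"
  then have "\<exists>a. std_num a \<and> val a = x" by (auto simp: dom_def)
  from someI_ex[OF this] show "std_num (rep x)" "val (rep x) = x" by (simp_all add: rep_def)
qed

lemma dom_cases: "x \<in> dom \<Longrightarrow> (\<And>a. std_num a \<Longrightarrow> x = val a \<Longrightarrow> thesis) \<Longrightarrow> thesis"
  by (auto simp: dom_def)

text \<open>The equality rule is applied to one argument at a time: first to the left summand, with
  the right one protected by \<open>lift_tm\<close>, then to the right one.\<close>

lemma val_Add_cong:
  assumes "val a = val a'" "val b = val b'" "std_num a" "std_num a'" "std_num b" "std_num b'"
  shows "val (Add a b) = val (Add a' b')"
proof -
  have "Eq a a' \<in> \<Delta>" "Eq b b' \<in> \<Delta>" using assms by (simp_all add: Eq_iff_val)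
  then have "Eq (Add a b) (Add a' b) \<in> \<Delta>" "Eq (Add a' b) (Add a' b') \<in> \<Delta>"
    using Eq_subst_mem[of a a' LN "Eq (lift_tm (Num LN) (Add a b)) (Add (nv LN 0) (lift_tm (Num LN) b))"]
      Eq_subst_mem[of b b' LN "Eq (lift_tm (Num LN) (Add a' b)) (Add (lift_tm (Num LN) a') (nv LN 0))"]
      assms by (simp_all add: subst0_atoms Eq_refl_mem)
  then show ?thesis using assms by (simp add: Eq_iff_val)
qed

lemma val_Mul_cong:
  assumes "val a = val a'" "val b = val b'" "std_num a" "std_num a'" "std_num b" "std_num b'"
  shows "val (Mul a b) = val (Mul a' b')"
proof -
  have "Eq a a' \<in> \<Delta>" "Eq b b' \<in> \<Delta>" using assms by (simp_all add: Eq_iff_val)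
  then have "Eq (Mul a b) (Mul a' b) \<in> \<Delta>" "Eq (Mul a' b) (Mul a' b') \<in> \<Delta>"
    using Eq_subst_mem[of a a' LN "Eq (lift_tm (Num LN) (Mul a b)) (Mul (nv LN 0) (lift_tm (Num LN) b))"]
      Eq_subst_mem[of b b' LN "Eq (lift_tm (Num LN) (Mul a' b)) (Mul (lift_tm (Num LN) a') (nv LN 0))"]
      assms by (simp_all add: subst0_atoms Eq_refl_mem)
  then show ?thesis using assms by (simp add: Eq_iff_val)
qed

lemma val_Exp_cong:
  assumes "val a = val a'" "std_num a" "std_num a'"
  shows "val (Exp a) = val (Exp a')"
proof -
  have "Eq a a' \<in> \<Delta>" using assms by (simp add: Eq_iff_val)
  then have "Eq (Exp a) (Exp a') \<in> \<Delta>"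
    using Eq_subst_mem[of a a' LN "Eq (lift_tm (Num LN) (Exp a)) (Exp (nv LN 0))"]
      assms by (simp add: subst0_atoms Eq_refl_mem)
  then show ?thesis using assms by (simp add: Eq_iff_val)
qed

lemma Lt_cong:
  assumes "Lt a b \<in> \<Delta>" "val a = val a'" "val b = val b'"
    "std_num a" "std_num a'" "std_num b" "std_num b'"
  shows "Lt a' b' \<in> \<Delta>"
proof -
  have "Eq a a' \<in> \<Delta>" "Eq b b' \<in> \<Delta>" using assms by (simp_all add: Eq_iff_val)
  moreover from this have "Lt a' b \<in> \<Delta>"
    using Eq_subst_mem[of a a' LN "Lt (nv LN 0) (lift_tm (Num LN) b)"] assms
    by (simp add: subst0_atoms)
  ultimately show ?thesis
    using Eq_subst_mem[of b b' LN "Lt (lift_tm (Num LN) a') (nv LN 0)"] assms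
    by (simp add: subst0_atoms)
qed

lemma val_simps [simp]:
  "std_num a \<Longrightarrow> std_num b \<Longrightarrow> val (Add a b) = val a \<oplus> val b"
  "std_num a \<Longrightarrow> std_num b \<Longrightarrow> val (Mul a b) = val a \<otimes> val b"
  "std_num a \<Longrightarrow> val (Exp a) = power2 (val a)"
  unfolding plus_def times_def power2_def
  by (rule val_Add_cong val_Mul_cong val_Exp_cong; simp add: rep)+

lemma dom_closed [simp]:
  "x \<in> dom \<Longrightarrow> y \<in> dom \<Longrightarrow> x \<oplus> y \<in> dom"
  "x \<in> dom \<Longrightarrow> y \<in> dom \<Longrightarrow> x \<otimes> y \<in> dom"
  "x \<in> dom \<Longrightarrow> power2 x \<in> dom"
  unfolding plus_def times_def power2_def by (simp_all add: rep del: val_simps)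

lemma Lt_iff_val: "std_num a \<Longrightarrow> std_num b \<Longrightarrow> Lt a b \<in> \<Delta> \<longleftrightarrow> val a \<prec> val b"
  unfolding less_def
  using Lt_cong[of a b "rep (val a)" "rep (val b)"] Lt_cong[of "rep (val a)" "rep (val b)" a b]
  by (auto simp: rep)

lemmas atom_iffs = Eq_iff_val Lt_iff_val

lemma basic_axiom_mem:
  assumes "A \<in> basic_axioms LN" "std_num a" "std_num b"
  shows "subst (subst_at LN (list_env [a, b]) (sv LN)) A \<in> \<Delta>"
  by (rule axiom_mem)
    (use assms std_num_list_env[of "[a, b]"] in
      \<open>auto intro!: NSA_axioms.intros(1) wf_subst_at simp: ISigma1_def simp del: list_env.simps\<close>)

lemma arithmetic_axioms:
  assumes "x \<in> dom" "y \<in> dom"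
  shows "x \<oplus> \<one> \<noteq> \<zero>"
    and "x \<oplus> \<one> = y \<oplus> \<one> \<longleftrightarrow> x = y"
    and "x \<oplus> \<zero> = x"
    and "x \<oplus> (y \<oplus> \<one>) = (x \<oplus> y) \<oplus> \<one>"
    and "x \<otimes> \<zero> = \<zero>"
    and "x \<otimes> (y \<oplus> \<one>) = (x \<otimes> y) \<oplus> x"
    and "\<not> x \<prec> \<zero>"
    and "x \<prec> y \<oplus> \<one> \<longleftrightarrow> x \<prec> y \<or> x = y"
    and "power2 \<zero> = \<one>"
    and "power2 (x \<oplus> \<one>) = power2 x \<oplus> power2 x"
proof -
  obtain a b where t: "std_num a" "std_num b" "x = val a" "y = val b"
    using assms dom_cases by metis
  have "\<forall>A\<in>basic_axioms LN. subst (subst_at LN (list_env [a, b]) (sv LN)) A \<in> \<Delta>"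
    using basic_axiom_mem t by blast
  then have ax: "x \<oplus> \<one> \<noteq> \<zero> \<and> (x \<oplus> \<one> = y \<oplus> \<one> \<longrightarrow> x = y) \<and> x \<oplus> \<zero> = x \<and>
    x \<oplus> (y \<oplus> \<one>) = (x \<oplus> y) \<oplus> \<one> \<and> x \<otimes> \<zero> = \<zero> \<and> x \<otimes> (y \<oplus> \<one>) = (x \<otimes> y) \<oplus> x \<and>
    \<not> x \<prec> \<zero> \<and> (x \<prec> y \<oplus> \<one> \<longleftrightarrow> x \<prec> y \<or> x = y) \<and> power2 \<zero> = \<one> \<and>
    power2 (x \<oplus> \<one>) = power2 x \<oplus> power2 x"
    using t by (simp add: basic_axioms_def Let_def connective_iffs atom_iffs) metis
  show "x \<oplus> \<one> \<noteq> \<zero>" "x \<oplus> \<one> = y \<oplus> \<one> \<longleftrightarrow> x = y" "x \<oplus> \<zero> = x"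
    "x \<oplus> (y \<oplus> \<one>) = (x \<oplus> y) \<oplus> \<one>" "x \<otimes> \<zero> = \<zero>" "x \<otimes> (y \<oplus> \<one>) = (x \<otimes> y) \<oplus> x"
    "\<not> x \<prec> \<zero>" "x \<prec> y \<oplus> \<one> \<longleftrightarrow> x \<prec> y \<or> x = y" "power2 \<zero> = \<one>"
    "power2 (x \<oplus> \<one>) = power2 x \<oplus> power2 x"
    using ax by auto
qed

text \<open>Clauses that mention \<open>x\<close> alone are instantiated with zero for
  \<open>y\<close>, so that as rewrite rules they leave no free variable in a side
  condition.\<close>

lemmas arithmetic_simps =
  arithmetic_axioms(2)
  arithmetic_axioms(1,3,5,7,10)[OF _ val_mem_dom[of "ZeroT LN"], simplified]
  arithmetic_axioms(4,6,8)

declare arithmetic_simps [simp]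

lemma zero_plus_one_neq [simp]: "\<zero> \<noteq> x \<oplus> \<one>" if "x \<in> dom"
  using that arithmetic_simps(2) by metis

lemma power2_zero [simp]: "power2 \<zero> = \<one>"
  using arithmetic_axioms(9)[OF val_mem_dom val_mem_dom, of "ZeroT LN" "ZeroT LN"] by simp

section \<open>Sigma-1 induction in the model\<close>

lemma Sig1_iff:
  "subst \<theta> (Sig1 LN k t \<phi>) \<in> \<Delta> \<longleftrightarrow> (\<exists>m. std_num m \<and>
    inst LN (case_nat m (case_nat (subst_tm \<theta> t) (\<lambda>i. \<theta> (Num LN) (i + k)))) (\<theta> (Set LN)) \<phi> \<in> \<Delta>)"
proof -
  let ?ts = "[nv LN 0, lift_tm (Num LN) t]"
  have "(\<lambda>i. subst_tm (push (Num LN) m \<theta>) (if i < length ?ts then ?ts ! i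
        else embed LN LN (nv LN (i - length ?ts + Suc k)))) =
      case_nat m (case_nat (subst_tm \<theta> t) (\<lambda>i. \<theta> (Num LN) (i + k)))" for m
    by (rule ext) (auto simp: less_Suc_eq_0_disj nth_Cons' split: nat.split)
  moreover have "(\<lambda>j. subst_tm (push (Num LN) m \<theta>) (embed LN LN (sv LN (j + 0)))) = \<theta> (Set LN)" for m
    by (rule ext) (simp add: push_def)
  ultimately show ?thesis
    unfolding Sig1_def subst_quantifier_iff app.simps subst_inst by simp
qed

lemma Sigma1_induct_mem:
  assumes sorts: "\<And>i. std_num (\<nu> i)" "\<And>j. has_sort (\<sigma> j) (Set LN)" and x: "std_num x"
    and base: "\<exists>m. std_num m \<and> inst LN (case_nat m (case_nat (ZeroT LN) \<nu>)) \<sigma> \<phi> \<in> \<Delta>"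
    and step: "\<And>x. std_num x \<Longrightarrow>
      \<exists>m. std_num m \<and> inst LN (case_nat m (case_nat x \<nu>)) \<sigma> \<phi> \<in> \<Delta> \<Longrightarrow>
      \<exists>m. std_num m \<and> inst LN (case_nat m (case_nat (Add x (OneT LN)) \<nu>)) \<sigma> \<phi> \<in> \<Delta>"
  shows "\<exists>m. std_num m \<and> inst LN (case_nat m (case_nat x \<nu>)) \<sigma> \<phi> \<in> \<Delta>"
proof -
  let ?A = "Imp (Conj (Sig1 LN 0 (ZeroT LN) \<phi>)
      (Forall (Num LN) (Imp (Sig1 LN 1 (nv LN 0) \<phi>) (Sig1 LN 1 (Add (nv LN 0) (OneT LN)) \<phi>))))
    (Forall (Num LN) (Sig1 LN 1 (nv LN 0) \<phi>))"
  have "?A \<in> NSA_axioms"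
    by (rule NSA_axioms.intros(1)) (auto simp: ISigma1_def Sigma1_induction_def)
  then have "subst (subst_at LN \<nu> \<sigma>) ?A \<in> \<Delta>"
    by (rule axiom_mem) (rule wf_subst_at[OF sorts])
  moreover have "push (Num LN) t (subst_at LN \<nu> \<sigma>) (Num LN) = case_nat t \<nu>"
    "push (Num LN) t (subst_at LN \<nu> \<sigma>) (Set LN) = \<sigma>" for t
    by (auto simp: push_def fun_eq_iff split: nat.split)
  ultimately show ?thesis
    using base step x
    by (simp add: connective_iffs subst_quantifier_iff Sig1_iff del: subst.simps(10,11))
qed

text \<open>Induction in the model is limited to properties with a Sigma-1 definition, which
  \<open>defn\<close> records. In \<open>\<phi>\<close>, variable 0 is the existential witness,
  variable 1 the induction variable, and the others are parameters from
  \<open>\<nu>\<close>.\<close>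

lemma dom_induct_Sigma1:
  assumes "\<And>i. std_num (\<nu> i)" "x \<in> dom"
    and defn: "\<And>s t. std_num s \<Longrightarrow> std_num t \<Longrightarrow>
      inst LN (case_nat s (case_nat t \<nu>)) (sv LN) \<phi> \<in> \<Delta> \<longleftrightarrow> Q (val s) (val t)"
    and base: "\<exists>m\<in>dom. Q m \<zero>"
    and step: "\<And>x m. x \<in> dom \<Longrightarrow> m \<in> dom \<Longrightarrow> Q m x \<Longrightarrow> \<exists>m\<in>dom. Q m (x \<oplus> \<one>)"
  shows "\<exists>m\<in>dom. Q m x"
proof -
  obtain t where t: "std_num t" "x = val t" using assms(2) by (rule dom_cases)
  have ex: "(\<exists>m. std_num m \<and> inst LN (case_nat m (case_nat t \<nu>)) (sv LN) \<phi> \<in> \<Delta>) \<longleftrightarrow>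
      (\<exists>m\<in>dom. Q m (val t))" if "std_num t" for t
    using defn[OF _ that] by (auto simp: dom_def)
  have "\<exists>m. std_num m \<and> inst LN (case_nat m (case_nat t \<nu>)) (sv LN) \<phi> \<in> \<Delta>"
  proof (rule Sigma1_induct_mem)
    show "\<exists>m. std_num m \<and> inst LN (case_nat m (case_nat (Add x (OneT LN)) \<nu>)) (sv LN) \<phi> \<in> \<Delta>"
      if "std_num x" "\<exists>m. std_num m \<and> inst LN (case_nat m (case_nat x \<nu>)) (sv LN) \<phi> \<in> \<Delta>" for x
      using that step[of "val x"] unfolding ex[OF that(1)] by (simp add: ex) blast
  qed (use assms(1) base t in \<open>simp_all add: ex\<close>)
  then show ?thesis using t ex by simp
qed

text \<open>The Sigma-1 case with a vacuous witness, past which \<open>ren Suc\<close> shifts the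
  variables of \<open>\<phi>\<close>.\<close>

lemma dom_induct:
  assumes "\<And>i. std_num (\<nu> i)" "x \<in> dom"
    and defn: "\<And>t. std_num t \<Longrightarrow> inst LN (case_nat t \<nu>) (sv LN) \<phi> \<in> \<Delta> \<longleftrightarrow> P (val t)"
    and "P \<zero>" "\<And>x. x \<in> dom \<Longrightarrow> P x \<Longrightarrow> P (x \<oplus> \<one>)"
  shows "P x"
proof -
  have "\<exists>m\<in>dom. P x"
  proof (rule dom_induct_Sigma1)
    show "inst LN (case_nat s (case_nat t \<nu>)) (sv LN) (ren Suc (\<lambda>j. j) \<phi>) \<in> \<Delta> \<longleftrightarrow> P (val t)"
      if "std_num t" for s t
      using defn[OF that] by (simp add: inst_ren)
  qed (use assms in \<open>auto intro: val_mem_dom\<close>)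
  then show ?thesis by blast
qed


section \<open>The semiring laws, by Delta-0 induction\<close>

lemma zero_plus [simp]: "x \<in> dom \<Longrightarrow> \<zero> \<oplus> x = x"
  by (rule dom_induct[where \<nu> = "list_env []" and \<phi> = "DEq (DAdd DZero (DVar 0)) (DVar 0)"])
    (simp_all add: atom_iffs)

lemma succ_plus:
  assumes "x \<in> dom" "y \<in> dom"
  shows "(x \<oplus> \<one>) \<oplus> y = (x \<oplus> y) \<oplus> \<one>"
proof -
  obtain a where "std_num a" "x = val a" using assms(1) by (rule dom_cases)
  then show ?thesis
    by (intro dom_induct[OF _ assms(2), where \<nu> = "list_env [a]"
          and P = "\<lambda>y. (x \<oplus> \<one>) \<oplus> y = (x \<oplus> y) \<oplus> \<one>"
          and \<phi> = "DEq (DAdd (DAdd (DVar 1) DOne) (DVar 0)) (DAdd (DAdd (DVar 1) (DVar 0)) DOne)"])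
      (simp_all add: atom_iffs)
qed

lemma plus_commute:
  assumes "x \<in> dom" "y \<in> dom"
  shows "x \<oplus> y = y \<oplus> x"
proof -
  obtain a where "std_num a" "x = val a" using assms(1) by (rule dom_cases)
  then show ?thesis
    by (intro dom_induct[OF _ assms(2), where \<nu> = "list_env [a]" and P = "\<lambda>y. x \<oplus> y = y \<oplus> x"
          and \<phi> = "DEq (DAdd (DVar 1) (DVar 0)) (DAdd (DVar 0) (DVar 1))"])
      (simp_all add: atom_iffs succ_plus)
qed

lemma plus_assoc:
  assumes "x \<in> dom" "y \<in> dom" "z \<in> dom"
  shows "(x \<oplus> y) \<oplus> z = x \<oplus> (y \<oplus> z)"
proof -
  obtain a b where "std_num a" "x = val a" "std_num b" "y = val b"
    using assms(1,2) dom_cases by metis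
  then show ?thesis
    by (intro dom_induct[OF _ assms(3), where \<nu> = "list_env [a, b]"
          and P = "\<lambda>z. (x \<oplus> y) \<oplus> z = x \<oplus> (y \<oplus> z)"
          and \<phi> = "DEq (DAdd (DAdd (DVar 1) (DVar 2)) (DVar 0)) (DAdd (DVar 1) (DAdd (DVar 2) (DVar 0)))"])
      (simp_all add: atom_iffs)
qed

lemma plus_cancel:
  assumes "x \<in> dom" "y \<in> dom" "z \<in> dom"
  shows "x \<oplus> z = y \<oplus> z \<longleftrightarrow> x = y"
proof -
  obtain a b where "std_num a" "x = val a" "std_num b" "y = val b"
    using assms(1,2) dom_cases by metis
  then have "x \<oplus> z = y \<oplus> z \<longrightarrow> x = y"
    by (intro dom_induct[OF _ assms(3), where \<nu> = "list_env [a, b]"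
          and P = "\<lambda>z. x \<oplus> z = y \<oplus> z \<longrightarrow> x = y"
          and \<phi> = "DImp (DEq (DAdd (DVar 1) (DVar 0)) (DAdd (DVar 2) (DVar 0))) (DEq (DVar 1) (DVar 2))"])
      (simp_all add: atom_iffs connective_iffs)
  then show ?thesis by blast
qed

text \<open>From here on sums are normalized by associativity and commutativity, which clashes with the
  recursion equation for addition as a rewrite rule.\<close>

declare arithmetic_axioms(4) [simp del]

lemma plus_left_commute:
  "x \<in> dom \<Longrightarrow> y \<in> dom \<Longrightarrow> z \<in> dom \<Longrightarrow> x \<oplus> (y \<oplus> z) = y \<oplus> (x \<oplus> z)"
  using plus_assoc plus_commute by metis

lemmas plus_ac = plus_assoc plus_commute plus_left_commute

lemma zero_times [simp]: "x \<in> dom \<Longrightarrow> \<zero> \<otimes> x = \<zero>"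
  by (rule dom_induct[where \<nu> = "list_env []" and \<phi> = "DEq (DMul DZero (DVar 0)) DZero"])
    (simp_all add: atom_iffs)

lemma times_one [simp]: "x \<in> dom \<Longrightarrow> x \<otimes> \<one> = x"
  using arithmetic_axioms(6)[of x \<zero>] by simp

lemma succ_times:
  assumes "x \<in> dom" "y \<in> dom"
  shows "(x \<oplus> \<one>) \<otimes> y = x \<otimes> y \<oplus> y"
proof -
  obtain a where "std_num a" "x = val a" using assms(1) by (rule dom_cases)
  then show ?thesis
    by (intro dom_induct[OF _ assms(2), where \<nu> = "list_env [a]"
          and P = "\<lambda>y. (x \<oplus> \<one>) \<otimes> y = x \<otimes> y \<oplus> y"
          and \<phi> = "DEq (DMul (DAdd (DVar 1) DOne) (DVar 0)) (DAdd (DMul (DVar 1) (DVar 0)) (DVar 0))"])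
      (simp_all add: atom_iffs plus_ac)
qed

lemma times_commute:
  assumes "x \<in> dom" "y \<in> dom"
  shows "x \<otimes> y = y \<otimes> x"
proof -
  obtain a where "std_num a" "x = val a" using assms(1) by (rule dom_cases)
  then show ?thesis
    by (intro dom_induct[OF _ assms(2), where \<nu> = "list_env [a]" and P = "\<lambda>y. x \<otimes> y = y \<otimes> x"
          and \<phi> = "DEq (DMul (DVar 1) (DVar 0)) (DMul (DVar 0) (DVar 1))"])
      (simp_all add: atom_iffs succ_times)
qed

lemma distrib_left:
  assumes "x \<in> dom" "y \<in> dom" "z \<in> dom"
  shows "x \<otimes> (y \<oplus> z) = x \<otimes> y \<oplus> x \<otimes> z"
proof -
  obtain a b where "std_num a" "x = val a" "std_num b" "y = val b"
    using assms(1,2) dom_cases by metis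
  moreover have "y \<oplus> (z \<oplus> \<one>) = (y \<oplus> z) \<oplus> \<one>" if "y \<in> dom" "z \<in> dom" for y z
    using that by (simp add: plus_assoc)
  ultimately show ?thesis
    by (intro dom_induct[OF _ assms(3), where \<nu> = "list_env [a, b]"
          and P = "\<lambda>z. x \<otimes> (y \<oplus> z) = x \<otimes> y \<oplus> x \<otimes> z"
          and \<phi> = "DEq (DMul (DVar 1) (DAdd (DVar 2) (DVar 0)))
            (DAdd (DMul (DVar 1) (DVar 2)) (DMul (DVar 1) (DVar 0)))"])
      (simp_all add: atom_iffs plus_assoc[of "val a \<otimes> val b"])
qed

lemma distrib_right:
  "x \<in> dom \<Longrightarrow> y \<in> dom \<Longrightarrow> z \<in> dom \<Longrightarrow> (x \<oplus> y) \<otimes> z = x \<otimes> z \<oplus> y \<otimes> z"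
  using distrib_left[of z x y] times_commute[of z] by simp

section \<open>Zero, successors and order\<close>

lemma plus_eq_zero:
  assumes "x \<in> dom" "y \<in> dom" "x \<oplus> y = \<zero>"
  shows "x = \<zero>" "y = \<zero>"
proof -
  have *: "y = \<zero>" if x: "x \<in> dom" and y: "y \<in> dom" and eq: "x \<oplus> y = \<zero>" for x y
  proof -
    obtain a where "std_num a" "x = val a" using x by (rule dom_cases)
    then have "x \<oplus> y = \<zero> \<longrightarrow> y = \<zero>"
      by (intro dom_induct[OF _ y, where \<nu> = "list_env [a]" and P = "\<lambda>y. x \<oplus> y = \<zero> \<longrightarrow> y = \<zero>"
            and \<phi> = "DImp (DEq (DAdd (DVar 1) (DVar 0)) DZero) (DEq (DVar 0) DZero)"])
        (simp_all add: atom_iffs connective_iffs plus_assoc[symmetric])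
    with eq show ?thesis by blast
  qed
  show "x = \<zero>" "y = \<zero>" using *[of x y] *[of y x] assms plus_commute[of x y] by simp_all
qed

text \<open>The predecessor is the witness of a Sigma-1 induction; in the step from \<open>x\<close>
  it is \<open>x\<close> itself.\<close>

lemma zero_or_succ:
  assumes "x \<in> dom"
  shows "x = \<zero> \<or> (\<exists>y\<in>dom. x = y \<oplus> \<one>)"
proof -
  have "\<exists>m\<in>dom. x = \<zero> \<or> x = m \<oplus> \<one>"
    by (rule dom_induct_Sigma1[OF _ assms, where \<nu> = "list_env []"
          and Q = "\<lambda>m x. x = \<zero> \<or> x = m \<oplus> \<one>" and \<phi> = "DDisj (DEq (DVar 1) DZero) (DEq (DVar 1) (DAdd (DVar 0) DOne))"])
      (auto simp: atom_iffs connective_iffs intro: exI[of _ \<zero>])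
  then show ?thesis by blast
qed

text \<open>Sigma-1 induction on \<open>x\<close> with the difference \<open>k\<close> as witness.
  Passing to the successor of \<open>x\<close> raises \<open>k\<close> if \<open>x\<close> is at or
  above \<open>y\<close> and lowers it below; splitting \<open>k\<close> into zero and successors
  marks the turning point.\<close>

lemma linear:
  assumes "x \<in> dom" "y \<in> dom"
  shows "\<exists>k\<in>dom. x \<oplus> k = y \<or> y \<oplus> k = x"
proof -
  obtain a where "std_num a" "y = val a" using assms(2) by (rule dom_cases)
  then show ?thesis
  proof (intro dom_induct_Sigma1[OF _ assms(1), where \<nu> = "list_env [a]"
        and Q = "\<lambda>k x. x \<oplus> k = y \<or> y \<oplus> k = x"
        and \<phi> = "DDisj (DEq (DAdd (DVar 1) (DVar 0)) (DVar 2)) (DEq (DAdd (DVar 2) (DVar 0)) (DVar 1))"])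
    fix x k assume x: "x \<in> dom" and k: "k \<in> dom" and "x \<oplus> k = y \<or> y \<oplus> k = x"
    then consider "y \<oplus> k = x" | "x \<oplus> \<zero> = y" | j where "j \<in> dom" "x \<oplus> (j \<oplus> \<one>) = y"
      using zero_or_succ[OF k] by metis
    then show "\<exists>k\<in>dom. x \<oplus> \<one> \<oplus> k = y \<or> y \<oplus> k = x \<oplus> \<one>"
    proof cases
      case 1
      then have "y \<oplus> (k \<oplus> \<one>) = x \<oplus> \<one>" using assms(2) k by (simp add: plus_assoc[symmetric])
      then show ?thesis using k by (intro bexI[of _ "k \<oplus> \<one>"]) simp_all
    next
      case 2
      then have "y \<oplus> \<one> = x \<oplus> \<one>" using x by simp
      then show ?thesis by (intro bexI[of _ \<one>]) simp_all
    next
      case 3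
      then have "x \<oplus> \<one> \<oplus> j = y" using x by (simp add: plus_ac)
      then show ?thesis using 3 by blast
    qed
  qed (use assms in \<open>auto simp: atom_iffs connective_iffs intro!: bexI[of _ y]\<close>)
qed

lemma square_eq_zero:
  assumes "x \<in> dom" "x \<otimes> x = \<zero>"
  shows "x = \<zero>"
proof -
  have "(y \<oplus> \<one>) \<otimes> (y \<oplus> \<one>) \<noteq> \<zero>" if "y \<in> dom" for y
    using that by (simp add: plus_assoc[symmetric])
  then show ?thesis using zero_or_succ[OF assms(1)] assms(2) by blast
qed

lemma less_plus_succ:
  assumes "x \<in> dom" "z \<in> dom"
  shows "x \<prec> x \<oplus> z \<oplus> \<one>"
proof -
  obtain a where "std_num a" "x = val a" using assms(1) by (rule dom_cases)
  then show ?thesis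
    by (intro dom_induct[OF _ assms(2), where \<nu> = "list_env [a]" and P = "\<lambda>z. x \<prec> x \<oplus> z \<oplus> \<one>"
          and \<phi> = "DLt (DVar 1) (DAdd (DAdd (DVar 1) (DVar 0)) DOne)"])
      (simp_all add: atom_iffs plus_assoc[symmetric])
qed

lemma one_neq_zero [simp]: "\<one> \<noteq> \<zero>"
  using arithmetic_axioms(1)[of \<zero>, OF val_mem_dom val_mem_dom[of "ZeroT LN"]] by simp

lemma power2_succ:
  assumes "x \<in> dom"
  shows "\<exists>w\<in>dom. power2 x = w \<oplus> \<one>"
proof -
  have "power2 x \<noteq> \<zero>"
  proof (rule dom_induct[OF _ assms, where \<nu> = "list_env []" and P = "\<lambda>x. power2 x \<noteq> \<zero>"
          and \<phi> = "DNeg (DEq (DExp (DVar 0)) DZero)"])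
    show "power2 (x \<oplus> \<one>) \<noteq> \<zero>" if "x \<in> dom" "power2 x \<noteq> \<zero>" for x
      using that plus_eq_zero(1)[of "power2 x" "power2 x"] by auto
  qed (simp_all add: atom_iffs connective_iffs)
  then show ?thesis using zero_or_succ[of "power2 x"] assms by auto
qed

text \<open>With differences, transitivity is a matter of associativity.
  \<open>le_imp_less_succ\<close> is the bridge back to the order of the language, in which the
  bounds of quantifiers are stated.\<close>

definition le :: "tm set \<Rightarrow> tm set \<Rightarrow> bool" (infix \<open>\<preceq>\<close> 50) where
  "x \<preceq> y \<longleftrightarrow> (\<exists>z\<in>dom. y = x \<oplus> z)"

lemma le_trans:
  assumes "x \<in> dom" "x \<preceq> y" "y \<preceq> z"
  shows "x \<preceq> z"
proof -
  obtain u v where "u \<in> dom" "y = x \<oplus> u" "v \<in> dom" "z = y \<oplus> v"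
    using assms by (auto simp: le_def)
  then show ?thesis
    unfolding le_def using assms(1) by (intro bexI[of _ "u \<oplus> v"]) (simp_all add: plus_assoc)
qed

lemma le_plus: "x \<in> dom \<Longrightarrow> y \<in> dom \<Longrightarrow> x \<preceq> x \<oplus> y" "x \<in> dom \<Longrightarrow> y \<in> dom \<Longrightarrow> x \<preceq> y \<oplus> x"
  unfolding le_def using plus_commute by blast+

lemma le_square:
  assumes "x \<in> dom"
  shows "x \<preceq> x \<otimes> x"
  using zero_or_succ[OF assms]
proof
  assume "x = \<zero>"
  then show ?thesis using le_plus(1)[of \<zero> \<zero>] by simp
next
  assume "\<exists>y\<in>dom. x = y \<oplus> \<one>"
  then obtain y where y: "y \<in> dom" "x = y \<oplus> \<one>" by blast
  then have "x \<otimes> x = x \<otimes> y \<oplus> x" using assms by simp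
  then show ?thesis using le_plus(2)[of x "x \<otimes> y"] assms y(1) by simp
qed

lemma le_imp_less_succ: "x \<in> dom \<Longrightarrow> x \<preceq> y \<Longrightarrow> x \<prec> y \<oplus> \<one>"
  unfolding le_def using less_plus_succ by blast

lemma neq_plus_succ:
  assumes "x \<in> dom" "y \<in> dom"
  shows "x \<noteq> x \<oplus> (y \<oplus> \<one>)"
proof
  assume "x = x \<oplus> (y \<oplus> \<one>)"
  then have "\<zero> \<oplus> x = (y \<oplus> \<one>) \<oplus> x" using assms plus_commute[of x "y \<oplus> \<one>"] by simp
  then have "\<zero> = y \<oplus> \<one>" using plus_cancel[of \<zero> "y \<oplus> \<one>" x] assms by simp
  then show False using assms by simp
qed

section \<open>Pairing and coded sequence entries\<close>

definition pair :: "tm set \<Rightarrow> tm set \<Rightarrow> tm set" where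
  "pair x y = (x \<oplus> y) \<otimes> (x \<oplus> y) \<oplus> x"

lemma pair_dom [simp]: "x \<in> dom \<Longrightarrow> y \<in> dom \<Longrightarrow> pair x y \<in> dom"
  by (simp add: pair_def)

lemma pair_zero [simp]: "pair \<zero> \<zero> = \<zero>"
  by (simp add: pair_def)

lemma pair_eq_zero:
  assumes "x \<in> dom" "y \<in> dom" "pair x y = \<zero>"
  shows "x = \<zero>" "y = \<zero>"
proof -
  have s: "x \<oplus> y \<in> dom" using assms by simp
  note z = plus_eq_zero[OF dom_closed(2)[OF s s] assms(1) assms(3)[unfolded pair_def]]
  show "x = \<zero>" by (rule z(2))
  show "y = \<zero>" by (rule plus_eq_zero(2)[OF assms(1,2) square_eq_zero[OF s z(1)]])
qed

lemma le_pair: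
  assumes "x \<in> dom" "y \<in> dom"
  shows "x \<preceq> pair x y" "y \<preceq> pair x y"
proof -
  let ?s = "x \<oplus> y"
  have s: "?s \<in> dom" using assms by simp
  show "x \<preceq> pair x y" unfolding pair_def by (rule le_plus(2)[OF assms(1) dom_closed(2)[OF s s]])
  have "?s \<otimes> ?s \<preceq> pair x y" unfolding pair_def by (rule le_plus(1)[OF dom_closed(2)[OF s s] assms(1)])
  then have "?s \<preceq> pair x y" by (rule le_trans[OF s le_square[OF s]])
  then show "y \<preceq> pair x y" by (rule le_trans[OF assms(2) le_plus(2)[OF assms(2,1)]])
qed

text \<open>A square plus at most its root lies strictly below the next square.\<close>

lemma pair_eq_pair_zero:
  assumes x: "x \<in> dom" and y: "y \<in> dom" and m: "m \<in> dom" and eq: "pair x y = pair m \<zero>"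
  shows "y = \<zero>"
proof -
  define s where "s = x \<oplus> y"
  have s: "s \<in> dom" using x y by (simp add: s_def)
  have eq: "s \<otimes> s \<oplus> x = m \<otimes> m \<oplus> m" using eq m by (simp add: pair_def s_def)
  \<comment> \<open>The roots \<open>s\<close> and \<open>m\<close> are compared. If they are equal,
    \<open>x\<close> is the whole sum \<open>s\<close>; a difference in either direction would make
    a number equal to itself plus a successor.\<close>
  obtain k where k: "k \<in> dom" "s \<oplus> k = m \<or> m \<oplus> k = s" using linear[OF s m] by blast
  show ?thesis
    using zero_or_succ[OF k(1)]
  proof
    assume "k = \<zero>"
    then have "s = m" using k(2) s m by auto
    then have "x \<oplus> s \<otimes> s = s \<oplus> s \<otimes> s" using eq s x by (simp add: plus_commute)
    then have "x = s" using plus_cancel[of x s "s \<otimes> s"] s x by simp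
    then have "\<zero> \<oplus> x = y \<oplus> x" using x y by (simp add: s_def plus_commute)
    then show ?thesis using plus_cancel[of \<zero> y x] x y by simp
  next
    assume "\<exists>j\<in>dom. k = j \<oplus> \<one>"
    then obtain j where j: "j \<in> dom" "k = j \<oplus> \<one>" by blast
    from k(2) show ?thesis
    proof
      assume mk: "s \<oplus> k = m"
      \<comment> \<open>In the linear part, \<open>s\<close> is split as
        \<open>x \<oplus> y\<close>, so that \<open>s \<otimes> s \<oplus> x\<close> can be
        separated off, and \<open>k\<close> as \<open>j \<oplus> \<one>\<close>, which provides the
        successor.\<close>
      have "m \<otimes> m \<oplus> m = (s \<otimes> s \<oplus> s \<otimes> k \<oplus> (k \<otimes> s \<oplus> k \<otimes> k)) \<oplus> ((x \<oplus> y) \<oplus> (j \<oplus> \<one>))"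
        unfolding mk[symmetric] using s k(1) by
          (simp add: distrib_left distrib_right s_def[symmetric] j(2)[symmetric] plus_ac)
      also have "\<dots> = (s \<otimes> s \<oplus> x) \<oplus> ((y \<oplus> s \<otimes> k \<oplus> (k \<otimes> s \<oplus> k \<otimes> k) \<oplus> j) \<oplus> \<one>)"
        using s k(1) x y j(1) by (simp add: plus_ac)
      finally have "s \<otimes> s \<oplus> x = (s \<otimes> s \<oplus> x) \<oplus> ((y \<oplus> s \<otimes> k \<oplus> (k \<otimes> s \<oplus> k \<otimes> k) \<oplus> j) \<oplus> \<one>)"
        using eq by simp
      then show ?thesis using neq_plus_succ[of "s \<otimes> s \<oplus> x" "y \<oplus> s \<otimes> k \<oplus> (k \<otimes> s \<oplus> k \<otimes> k) \<oplus> j"]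
        s k(1) x y j(1) by simp
    next
      assume sk: "m \<oplus> k = s"
      have "s \<otimes> s \<oplus> x = (m \<otimes> m \<oplus> m \<otimes> k \<oplus> (k \<otimes> m \<oplus> k \<otimes> k)) \<oplus> x"
        unfolding sk[symmetric] using m k(1) by (simp add: distrib_left distrib_right plus_ac)
      \<comment> \<open>From \<open>m \<otimes> k\<close> comes the missing summand
        \<open>m\<close>, from \<open>k \<otimes> k\<close> below the successor.\<close>
      also have "m \<otimes> k = m \<otimes> j \<oplus> m" using m j by simp
      also have "k \<otimes> k = k \<otimes> j \<oplus> (j \<oplus> \<one>)" using k(1) j by simp
      also have "(m \<otimes> m \<oplus> (m \<otimes> j \<oplus> m) \<oplus> (k \<otimes> m \<oplus> (k \<otimes> j \<oplus> (j \<oplus> \<one>)))) \<oplus> x =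
          (m \<otimes> m \<oplus> m) \<oplus> ((m \<otimes> j \<oplus> (k \<otimes> m \<oplus> k \<otimes> j) \<oplus> j \<oplus> x) \<oplus> \<one>)"
        using m k(1) x j(1) by (simp add: plus_ac)
      finally have "m \<otimes> m \<oplus> m = (m \<otimes> m \<oplus> m) \<oplus> ((m \<otimes> j \<oplus> (k \<otimes> m \<oplus> k \<otimes> j) \<oplus> j \<oplus> x) \<oplus> \<one>)"
        using eq by simp
      then show ?thesis
        using neq_plus_succ[of "m \<otimes> m \<oplus> m" "m \<otimes> j \<oplus> (k \<otimes> m \<oplus> k \<otimes> j) \<oplus> j \<oplus> x"]
          m k(1) x j(1) by simp
    qed
  qed
qed

definition entry_val :: "tm set \<Rightarrow> tm set \<Rightarrow> tm set \<Rightarrow> tm set \<Rightarrow> tm set" where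
  "entry_val n a b d = pair n (pair (pair a b) d)"

lemma entry_val_dom [simp]:
  "n \<in> dom \<Longrightarrow> a \<in> dom \<Longrightarrow> b \<in> dom \<Longrightarrow> d \<in> dom \<Longrightarrow> entry_val n a b d \<in> dom"
  by (simp add: entry_val_def)

lemma le_entry_val:
  assumes "n \<in> dom" "a \<in> dom" "b \<in> dom" "d \<in> dom"
  shows "n \<preceq> entry_val n a b d" "a \<preceq> entry_val n a b d"
    "b \<preceq> entry_val n a b d" "d \<preceq> entry_val n a b d"
proof -
  let ?q = "pair (pair a b) d"
  show "n \<preceq> entry_val n a b d" using assms by (simp add: entry_val_def le_pair)
  have q: "?q \<preceq> entry_val n a b d" using assms by (simp add: entry_val_def le_pair)
  then show "d \<preceq> entry_val n a b d" using assms le_trans[OF _ le_pair(2) q] by simp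
  have "pair a b \<preceq> entry_val n a b d" using assms le_trans[OF _ le_pair(1) q] by simp
  from le_trans[OF _ le_pair(1) this] le_trans[OF _ le_pair(2) this]
  show "a \<preceq> entry_val n a b d" "b \<preceq> entry_val n a b d" using assms by simp_all
qed

text \<open>The right side is \<open>pair m \<zero>\<close>, which forces the code of the rational
  to vanish, and a pairing vanishes only with both components. So an entry with code zero cannot be
  read as an entry with another code.\<close>

lemma entry_val_eq_zero_entry:
  assumes "n \<in> dom" "a \<in> dom" "b \<in> dom" "d \<in> dom" "m \<in> dom"
    and "entry_val n a b d = entry_val m \<zero> \<zero> \<zero>"
  shows "a = \<zero>" "b = \<zero>" "d = \<zero>"
proof -
  have p: "pair a b \<in> dom" using assms by simp
  have "pair n (pair (pair a b) d) = pair m \<zero>" using assms by (simp add: entry_val_def)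
  note 1 = pair_eq_zero[OF p assms(4) pair_eq_pair_zero[OF assms(1) pair_dom[OF p assms(4)] assms(5) this]]
  show "d = \<zero>" by (rule 1(2))
  show "a = \<zero>" "b = \<zero>" by (rule pair_eq_zero[OF assms(2,3) 1(1)])+
qed

lemma val_entry:
  assumes "\<And>i. std_num (\<nu> i)"
  shows "val (inst_tm LN \<nu> (entry n a b d)) = entry_val (val (inst_tm LN \<nu> n))
    (val (inst_tm LN \<nu> a)) (val (inst_tm LN \<nu> b)) (val (inst_tm LN \<nu> d))"
  using has_sort_inst_tm[of \<nu> LN] assms
  by (simp add: entry_def dpair_def entry_val_def pair_def)

lemma zero_less_one: "\<zero> \<prec> \<one>"
  using less_plus_succ[of \<zero> \<zero>] by simp

text \<open>The inequality \<open>q_n > 2^(-n)\<close> for the value 2, cleared of denominators; it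
  makes entries with value 2 witnesses of positivity.\<close>

lemma one_less_two_times_power2:
  assumes "x \<in> dom"
  shows "\<one> \<prec> (\<one> \<oplus> \<one>) \<otimes> power2 x"
proof -
  obtain w where w: "w \<in> dom" "power2 x = w \<oplus> \<one>" using power2_succ[OF assms] by blast
  then have "(\<one> \<oplus> \<one>) \<otimes> power2 x = \<one> \<oplus> (w \<oplus> w) \<oplus> \<one>"
    by (simp add: distrib_right distrib_left plus_ac times_commute[of \<one> w])
  then show ?thesis using less_plus_succ[of \<one> "w \<oplus> w"] w(1) by simp
qed

lemma falsum_not_mem: "falsum \<notin> \<Delta>"
  by (simp add: falsum_def Eq_iff_val one_neq_zero[symmetric])

end


section \<open>Double hypernegation\<close>

lemma hyper_neg_eq: "hyper_neg A = Imp (Conj A (inT A)) (Conj falsum verum)"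
proof -
  have "nf falsum = falsum" by (simp add: falsum_def)
  then show ?thesis
    by (simp add: hyper_neg_def hyper_imp_def inT_def inT_nf_def transferred_simps)
qed

lemma inT_ExQ_LN: "inT (ExQ LN \<phi>) = verum"
  by (simp add: inT_def inT_nf_def nf_Q transferred_simps)

context henkin
begin

text \<open>Unless \<open>P\<close> holds, the first hypernegation together with its membership in T
  says that no nonstandard number is a witness. The second one therefore yields a nonstandard
  witness, and its membership in T a 1-finite one.\<close>

lemma hyper_double_neg_iff:
  "subst \<theta> (hyper_imp (hyper_neg (hyper_neg (ExQ LN \<phi>))) (ExQ LN \<phi>)) \<in> \<Delta> \<longleftrightarrow>
    (subst \<theta> (ExQ LStar \<phi>) \<in> \<Delta> \<longrightarrow> subst \<theta> (ExQ LN1 \<phi>) \<in> \<Delta> \<longrightarrow> subst \<theta> (ExQ LN \<phi>) \<in> \<Delta>)"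
proof -
  have f: "subst \<theta> falsum = falsum" "subst \<theta> verum = verum" by (simp_all add: falsum_def verum_def)
  have nn: "subst \<theta> (ExQ l (DNeg (DNeg \<phi>))) \<in> \<Delta> \<longleftrightarrow> subst \<theta> (ExQ l \<phi>) \<in> \<Delta>" for l
    by (simp add: ExQ_iff Neg_iff)
  have n: "subst \<theta> (AllQ l (DNeg \<phi>)) \<in> \<Delta> \<longleftrightarrow> subst \<theta> (ExQ l \<phi>) \<notin> \<Delta>" for l
    by (simp add: ExQ_iff_not_AllQ)
  show ?thesis
    \<comment> \<open>The memberships in T are rewritten from the outside in, each while the
      hypernegations inside it are still folded.\<close>
    unfolding hyper_imp_def hyper_neg_form(4)
    unfolding hyper_neg_eq[of "hyper_neg _"] hyper_neg_form(2)
    unfolding hyper_neg_eq[of "ExQ LN \<phi>"] inT_ExQ_LN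
    by (auto simp: connective_iffs f nn n falsum_not_mem)
qed

end

text \<open>By \<open>hyper_double_neg_iff\<close> it is enough to pass from a 1-finite witness to a
  standard one, which is the contrapositive of transfer for \<open>DNeg \<phi>\<close>.\<close>

lemma Pi1_TRANS_1_proves_MP:
  assumes "A \<in> MP"
  shows "proves Pi1_TRANS_1 {} A"
proof (rule proves_if_henkin)
  fix \<Delta> assume "henkin Pi1_TRANS_1 \<Delta>"
  then interpret henkin Pi1_TRANS_1 \<Delta> .
  obtain \<phi> where A: "A = hyper_imp (hyper_neg (hyper_neg (ExQ LN \<phi>))) (ExQ LN \<phi>)"
    using assms by (auto simp: MP_def)
  have "Imp (AllQ LN (DNeg \<phi>)) (AllQ LN1 (DNeg \<phi>)) \<in> \<Delta>"
    by (rule extra_axiom_mem) (auto simp: Pi1_TRANS_1_def)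
  then have "ExQ LN1 \<phi> \<in> \<Delta> \<longrightarrow> ExQ LN \<phi> \<in> \<Delta>"
    using ExQ_iff_not_AllQ[of Var] by (auto simp: Imp_iff)
  then show "A \<in> \<Delta>" using hyper_double_neg_iff[of Var \<phi>] by (simp add: A)
qed

definition positive_body :: dfm where
  "positive_body =
    DEx (DAdd (DVar 0) DOne) (DEx (DAdd (DVar 1) DOne)
    (DEx (DAdd (DVar 2) DOne) (DEx (DAdd (DVar 3) DOne)
      (DConj (DEq (DVar 4) (entry (DVar 3) (DVar 2) (DVar 1) (DVar 0)))
      (DConj (DMem (DVar 4) 0)
        (DLt (DAdd (DMul (DVar 1) (DExp (DVar 3))) (DAdd (DVar 0) DOne))
          (DMul (DVar 2) (DExp (DVar 3)))))))))"

lemma positive_eq: "positive = ExQ LN positive_body"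
  by (simp add: Defs.positive_def positive_body_def Let_def)

text \<open>\<open>positive\<close> is Sigma-1 with the set variable as a parameter. Free variables
  of extra axioms count as universally quantified, so this instance of MP may be generalized over
  the set.\<close>

lemma MP_proves_MPR: "proves MP {} MPR"
proof -
  have "hyper_imp (hyper_neg (hyper_neg positive)) positive \<in> MP"
    by (auto simp: MP_def positive_eq)
  then show ?thesis
    unfolding MPR_def by (intro proves.Forall_I proves.Imp_I proves.Extra_axiom)
qed


section \<open>The real number attached to a formula\<close>

text \<open>For \<open>\<phi>\<close> true of all standard numbers, the set \<open>{entry n 0 0 0 | n} \<union> {entry n 2 0 0 | n. \<not> \<phi> n}\<close>
  codes the real number 0, but its image at level 1 has the value 2 at every 1-finite
  counterexample to \<open>\<phi>\<close>.\<close>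

abbreviation dtwo :: dtm where "dtwo \<equiv> DAdd DOne DOne"

text \<open>Inside the bounded quantifier, variable 0 is \<open>n\<close> and variable 1 the
  candidate code; hence \<open>ren\<close> keeps \<open>n\<close> in place and moves the parameters
  of \<open>\<phi>\<close> one further, past the code.\<close>

definition witness_body :: "dfm \<Rightarrow> dfm" where
  "witness_body \<phi> =
    DEx (DAdd (DVar 0) DOne)
      (DDisj (DEq (DVar 1) (entry (DVar 0) DZero DZero DZero))
      (DConj (DEq (DVar 1) (entry (DVar 0) dtwo DZero DZero))
        (DNeg (ren (case_nat 0 (\<lambda>i. i + 2)) (\<lambda>j. j) \<phi>))))"

text \<open>A comprehension term carries finite lists of parameters, so a position is fixed from
  which on \<open>\<phi>\<close> is insensitive to its environment.\<close>

definition witness_bound :: "dfm \<Rightarrow> nat" where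
  "witness_bound \<phi> = (SOME n. \<forall>\<nu> \<nu>' \<sigma> \<sigma>'. (\<forall>i<n. \<nu> i = \<nu>' i \<and> \<sigma> i = \<sigma>' i) \<longrightarrow>
    inst LN \<nu> \<sigma> \<phi> = inst LN \<nu>' \<sigma>' \<phi>)"

lemma witness_bound:
  "(\<And>i. i < witness_bound \<phi> \<Longrightarrow> \<nu> i = \<nu>' i \<and> \<sigma> i = \<sigma>' i) \<Longrightarrow> inst LN \<nu> \<sigma> \<phi> = inst LN \<nu>' \<sigma>' \<phi>"
  using someI_ex[OF inst_cong_bounded[of LN \<phi>]] unfolding witness_bound_def by blast

definition witness_set :: "dfm \<Rightarrow> tm" where
  "witness_set \<phi> = Cmp (witness_body \<phi>) (map (nv LN) [0..<witness_bound \<phi>]) (map (sv LN) [0..<witness_bound \<phi>])"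

lemma has_sort_witness_set [simp]: "has_sort (witness_set \<phi>) (Set LN)"
  unfolding witness_set_def by (rule has_sort.intros(9)) auto

lemma std_subst: "subst \<theta> (std \<phi>) = inst LN (\<theta> (Num LN)) (\<theta> (Set LN)) \<phi>"
  by (simp add: std_def subst_inst)

context henkin
begin

lemma Mem_witness_set_iff:
  assumes p: "std_num p"
  shows "Mem p (witness_set \<phi>) \<in> \<Delta> \<longleftrightarrow> (\<exists>n. std_num n \<and>
    (val p = entry_val (val n) \<zero> \<zero> \<zero> \<or>
     val p = entry_val (val n) (\<one> \<oplus> \<one>) \<zero> \<zero> \<and> inst LN (case_nat n (nv LN)) (sv LN) \<phi> \<notin> \<Delta>))"
proof -
  let ?N = "witness_bound \<phi>"
  let ?ts = "map (nv LN) [0..<?N]" and ?Ss = "map (sv LN) [0..<?N]"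
  define \<nu> where "\<nu> = (\<lambda>i. if i < length ?ts then ?ts ! i else ZeroT LN)"
  define \<sigma> where "\<sigma> = (\<lambda>j. if j < length ?Ss then ?Ss ! j else Cmp (DNeg (DEq DZero DZero)) [] [])"
  have \<nu>: "std_num (\<nu> i)" for i by (simp add: \<nu>_def)
  \<comment> \<open>Past the listed variables \<open>\<nu>\<close> and \<open>\<sigma>\<close> take
    the default values zero and the empty set; by the choice of \<open>?N\<close> these positions do
    not affect \<open>\<phi>\<close>.\<close>
  have eq: "inst LN (case_nat n \<nu>) \<sigma> \<phi> = inst LN (case_nat n (nv LN)) (sv LN) \<phi>" for n
    by (rule witness_bound) (auto simp: \<nu>_def \<sigma>_def split: nat.split)
  have sorts: "std_num (case_nat p \<nu> i)" "std_num n \<Longrightarrow> std_num (case_nat n (case_nat p \<nu>) i)" for n i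
    using p \<nu> by simp_all
  have ren: "(\<lambda>i. case_nat n (case_nat p \<nu>) (case_nat 0 (\<lambda>i. i + 2) i)) = case_nat n \<nu>" for n
    by (rule ext) (auto split: nat.split)
  have "Mem p (witness_set \<phi>) \<in> \<Delta> \<longleftrightarrow> inst LN (case_nat p \<nu>) \<sigma> (witness_body \<phi>) \<in> \<Delta>"
    using Cmp_iff[OF has_sort_witness_set[unfolded witness_set_def] p] unfolding witness_set_def \<nu>_def \<sigma>_def .
  also have "\<dots> \<longleftrightarrow> (\<exists>n. std_num n \<and> val n \<prec> val p \<oplus> \<one> \<and>
    (val p = entry_val (val n) \<zero> \<zero> \<zero> \<or>
     val p = entry_val (val n) (\<one> \<oplus> \<one>) \<zero> \<zero> \<and> inst LN (case_nat n (nv LN)) (sv LN) \<phi> \<notin> \<Delta>))"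
    (is "_ \<longleftrightarrow> (\<exists>n. std_num n \<and> ?R n)")
  proof -
    have "Lt n (inst_tm LN (case_nat p \<nu>) (DAdd (DVar 0) DOne)) \<in> \<Delta> \<and>
        inst LN (case_nat n (case_nat p \<nu>)) \<sigma>
          (DDisj (DEq (DVar 1) (entry (DVar 0) DZero DZero DZero))
          (DConj (DEq (DVar 1) (entry (DVar 0) dtwo DZero DZero))
            (DNeg (ren (case_nat 0 (\<lambda>i. i + 2)) (\<lambda>j. j) \<phi>)))) \<in> \<Delta> \<longleftrightarrow> ?R n" if n: "std_num n" for n
    proof -
      note s = sorts(2)[OF n]
      have "inst LN (case_nat n (case_nat p \<nu>)) \<sigma> (ren (case_nat 0 (\<lambda>i. i + 2)) (\<lambda>j. j) \<phi>) =
          inst LN (case_nat n (nv LN)) (sv LN) \<phi>"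
        unfolding inst_ren ren by (rule eq)
      moreover have "std_num (inst_tm LN (case_nat n (case_nat p \<nu>)) t)" for t
        by (rule has_sort_inst_tm) (rule s)
      ultimately show ?thesis
        using n p by (simp add: connective_iffs atom_iffs val_entry[OF s])
    qed
    then show ?thesis
      unfolding witness_body_def inst_bounded_iff(2)[OF sorts(1)] by blast
  qed
  \<comment> \<open>The bound on \<open>n\<close> may be dropped, since \<open>n\<close> is at most
    its own entry \<open>val p\<close>.\<close>
  also have "\<dots> \<longleftrightarrow> (\<exists>n. std_num n \<and>
    (val p = entry_val (val n) \<zero> \<zero> \<zero> \<or>
     val p = entry_val (val n) (\<one> \<oplus> \<one>) \<zero> \<zero> \<and> inst LN (case_nat n (nv LN)) (sv LN) \<phi> \<notin> \<Delta>))"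
    using le_imp_less_succ[OF _ le_entry_val(1)] val_mem_dom dom_closed(1) has_sort_simps(2,3) by metis
  finally show ?thesis .
qed

end

section \<open>The witness set as a real number\<close>

lemma funpow_numeral: "(f ^^ numeral k) x = f ((f ^^ pred_numeral k) x)"
  by (simp add: numeral_eq_Suc)

context henkin
begin

lemmas sat_simps =
  funpow_numeral subst_quantifier_iff std_subst connective_iffs atom_iffs val_entry has_sort_inst_tm

text \<open>Without counterexamples the members with value 2 are absent and every entry has code
  zero. The Cauchy condition then reduces to \<open>\<zero> \<prec> \<one>\<close>, while positivity
  would require a number below zero.\<close>

lemma witness_set_is_zero:
  assumes all: "\<And>n. std_num n \<Longrightarrow> inst LN (case_nat n (nv LN)) (sv LN) \<phi> \<in> \<Delta>"
  shows "subst (push (Set LN) (witness_set \<phi>) Var) is_real \<in> \<Delta>"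
    and "subst (push (Set LN) (witness_set \<phi>) Var) positive \<notin> \<Delta>"
proof -
  let ?X = "witness_set \<phi>"
  have mem_iff: "Mem p ?X \<in> \<Delta> \<longleftrightarrow> (\<exists>n. std_num n \<and> val p = entry_val (val n) \<zero> \<zero> \<zero>)"
    if "std_num p" for p
    unfolding Mem_witness_set_iff[OF that] using all by blast
  note zero = entry_val_eq_zero_entry[OF val_mem_dom val_mem_dom val_mem_dom val_mem_dom val_mem_dom]
  have z: "std_num (ZeroT LN)" by simp
  let ?zero_entry = "\<lambda>n a b d. \<exists>m. std_num m \<and> entry_val n a b d = entry_val (val m) \<zero> \<zero> \<zero>"
  show "subst (push (Set LN) ?X Var) is_real \<in> \<Delta>"
    unfolding is_real_def is_rat_sequence_def
  \<comment> \<open>The recursion equation of multiplication is switched off, so that the arithmetic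
    subgoals keep the factored form in which they are stated below.\<close>
  proof (simp add: sat_simps mem_iff close_below_def Let_def
        del: subst.simps(10,11) arithmetic_axioms(6) cong: conj_cong,
      intro conjI allI impI; (elim conjE)?)
    fix t assume "\<exists>n. std_num n \<and> val t = entry_val (val n) \<zero> \<zero> \<zero>"
    then show "\<exists>n. std_num n \<and> (\<exists>a. std_num a \<and> (\<exists>b. std_num b \<and> (\<exists>d. std_num d \<and>
        val t = entry_val (val n) (val a) (val b) (val d))))"
      using z by blast
  next
    fix n assume "std_num n"
    then show "\<exists>a. std_num a \<and> (\<exists>b. std_num b \<and> (\<exists>d. std_num d \<and>
        ?zero_entry (val n) (val a) (val b) (val d)))"
      using z by blast
  next
    fix n a b d a' b' d'
    assume "?zero_entry (val n) (val a) (val b) (val d)" "?zero_entry (val n) (val a') (val b') (val d')"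
      "std_num n" "std_num a" "std_num b" "std_num d" "std_num a'" "std_num b'" "std_num d'"
    then show "val a = val a'" "val b = val b'" "val d = val d'" using zero by metis+
  next
    fix k i a b d a' b' d'
    assume t: "std_num k" "std_num i" "std_num a" "std_num b" "std_num d" "std_num a'" "std_num b'" "std_num d'"
      and e: "?zero_entry (val k) (val a) (val b) (val d)" "?zero_entry (val k \<oplus> val i) (val a') (val b') (val d')"
    have "val a = \<zero>" "val b = \<zero>" "val d = \<zero>" using e(1) t zero by metis+
    \<comment> \<open>\<open>zero\<close> speaks of values of terms, so the index
      \<open>val k \<oplus> val i\<close> is written as the value of \<open>Add k i\<close>.\<close>
    moreover have "?zero_entry (val (Add k i)) (val a') (val b') (val d')" using e(2) t by simp
    then have "val a' = \<zero>" "val b' = \<zero>" "val d' = \<zero>" using t zero has_sort_simps(4) by metis+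
    ultimately show
      "power2 (val k) \<otimes> (val a \<otimes> (val d' \<oplus> \<one>) \<oplus> val b' \<otimes> (val d \<oplus> \<one>)) \<prec>
        power2 (val k) \<otimes> (val b \<otimes> (val d' \<oplus> \<one>) \<oplus> val a' \<otimes> (val d \<oplus> \<one>)) \<oplus>
        (val d \<oplus> \<one>) \<otimes> (val d' \<oplus> \<one>)"
      "power2 (val k) \<otimes> (val a' \<otimes> (val d \<oplus> \<one>) \<oplus> val b \<otimes> (val d' \<oplus> \<one>)) \<prec>
        power2 (val k) \<otimes> (val b' \<otimes> (val d \<oplus> \<one>) \<oplus> val a \<otimes> (val d' \<oplus> \<one>)) \<oplus>
        (val d' \<oplus> \<one>) \<otimes> (val d \<oplus> \<one>)"
      using t by (simp_all add: zero_less_one)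
  qed
  show "subst (push (Set LN) ?X Var) positive \<notin> \<Delta>"
  proof
    assume "subst (push (Set LN) ?X Var) positive \<in> \<Delta>"
    then obtain p n a b d where t: "std_num p" "std_num n" "std_num a" "std_num b" "std_num d"
      and p: "val p = entry_val (val n) (val a) (val b) (val d)" "Mem p ?X \<in> \<Delta>"
      and lt: "val b \<otimes> power2 (val n) \<oplus> (val d \<oplus> \<one>) \<prec> val a \<otimes> power2 (val n)"
      unfolding positive_eq positive_body_def ExQ_iff
      by (auto simp: sat_simps inst_bounded_iff simp del: inst.simps(8,9) cong: conj_cong)
    have "val a = \<zero>" using p t mem_iff[OF t(1)] zero by metis
    then show False using lt t by simp
  qed
qed

text \<open>Each component is at most the code \<open>p\<close>, so the bounds of the four
  quantifiers hold automatically.\<close>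

lemma positive_body_memI:
  assumes "\<And>i. std_num (\<nu> i)" "std_num p" "std_num n" "std_num a" "std_num b" "std_num d"
    and p: "val p = entry_val (val n) (val a) (val b) (val d)" "Mem p (\<sigma> 0) \<in> \<Delta>"
    and "val b \<otimes> power2 (val n) \<oplus> (val d \<oplus> \<one>) \<prec> val a \<otimes> power2 (val n)"
  shows "inst LN (case_nat p \<nu>) \<sigma> positive_body \<in> \<Delta>"
proof -
  have "val n \<prec> val p \<oplus> \<one>" "val a \<prec> val p \<oplus> \<one>" "val b \<prec> val p \<oplus> \<one>" "val d \<prec> val p \<oplus> \<one>"
    unfolding p using assms(3-6) by (intro le_imp_less_succ le_entry_val; simp)+
  then have "\<exists>n. std_num n \<and> val n \<prec> val p \<oplus> \<one> \<and> (\<exists>a. std_num a \<and> val a \<prec> val p \<oplus> \<one> \<and>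
      (\<exists>b. std_num b \<and> val b \<prec> val p \<oplus> \<one> \<and> (\<exists>d. std_num d \<and> val d \<prec> val p \<oplus> \<one> \<and>
        val p = entry_val (val n) (val a) (val b) (val d) \<and> Mem p (\<sigma> 0) \<in> \<Delta> \<and>
        val b \<otimes> power2 (val n) \<oplus> (val d \<oplus> \<one>) \<prec> val a \<otimes> power2 (val n))))"
    using assms by blast
  then show ?thesis
    using assms(1,2) unfolding positive_body_def
    by (simp add: sat_simps inst_bounded_iff del: inst.simps(8,9) arithmetic_axioms(8) cong: conj_cong)
qed

end

section \<open>Transfer to level 1 from MPR\<close>

lemma positive_body_cong: "inst l (case_nat p \<nu>) \<sigma> positive_body = inst l (case_nat p \<nu>') \<sigma> positive_body"
  by (simp add: positive_body_def entry_def dpair_def bind_def)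

lemma MPR_proves_Pi1_TRANS_1:
  assumes "A \<in> Pi1_TRANS_1"
  shows "proves {MPR} {} A"
proof (rule proves_if_henkin)
  fix \<Delta> assume "henkin {MPR} \<Delta>"
  then interpret henkin "{MPR}" \<Delta> .
  obtain \<phi> where A: "A = Imp (AllQ LN \<phi>) (AllQ LN1 \<phi>)"
    using assms by (auto simp: Pi1_TRANS_1_def)
  let ?X = "witness_set \<phi>"
  \<comment> \<open>MPR will be used at \<open>?X\<close>: set variable 0 becomes \<open>?X\<close>,
    and the set parameters of \<open>\<phi>\<close> move up by one, hence the \<open>Suc\<close> in
    \<open>\<Theta>\<close> below.\<close>
  let ?\<theta> = "push (Set LN) ?X Var"
  let ?t = "DAdd (entry (DVar 0) dtwo DZero DZero) DOne"
  \<comment> \<open>A number violating \<open>\<phi>\<close> has to produce a witness of positivity,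
    and the entry of value 2 is one. Bounding the witness by \<open>?t\<close> keeps the statement
    Delta-0, as the transfer rule demands.\<close>
  define \<Theta> where "\<Theta> = DDisj (ren (\<lambda>i. i) Suc \<phi>) (DEx ?t positive_body)"
  have \<Theta>: "proves {} {} (subst ?\<theta> (AllQ LN \<Theta>))"
  \<comment> \<open>The transfer rule accepts theorems of NSA proper only, so this is verified in
    Henkin theories without extra axioms, and with no assumption that \<open>\<phi>\<close> holds
    throughout.\<close>
  proof (rule proves_if_henkin)
    fix \<Delta> assume "henkin {} \<Delta>"
    then interpret std: henkin "{}" \<Delta> .
    show "subst ?\<theta> (AllQ LN \<Theta>) \<in> \<Delta>"
      unfolding std.AllQ_iff
    proof (intro allI impI)
      fix n assume n: "std_num n"
      let ?\<nu> = "case_nat n (nv LN)" and ?\<sigma> = "case_nat ?X (sv LN)"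
      have \<nu>: "std_num (?\<nu> i)" for i using n by simp
      let ?p = "inst_tm LN ?\<nu> (entry (DVar 0) dtwo DZero DZero)"
      have p: "std_num ?p" by (rule has_sort_inst_tm) (rule \<nu>)
      have val_p: "std.val ?p = std.entry_val (std.val n) (std.val (Add (OneT LN) (OneT LN)))
          (std.val (ZeroT LN)) (std.val (ZeroT LN))"
        using \<nu> by (simp add: std.val_entry)
      have "inst LN (case_nat ?p ?\<nu>) ?\<sigma> positive_body \<in> \<Delta>"
        if "inst LN ?\<nu> (sv LN) \<phi> \<notin> \<Delta>"
      proof (rule std.positive_body_memI[OF \<nu> p n _ _ _ val_p])
        show "Mem ?p (?\<sigma> 0) \<in> \<Delta>"
          using that n val_p by (auto simp: std.Mem_witness_set_iff[OF p])
      qed (use n in \<open>simp_all add: std.one_less_two_times_power2\<close>)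
      moreover have "Lt ?p (inst_tm LN ?\<nu> ?t) \<in> \<Delta>"
        using p by (simp add: std.atom_iffs)
      ultimately have "inst LN ?\<nu> ?\<sigma> \<Theta> \<in> \<Delta>"
        using p unfolding \<Theta>_def inst.simps(6) std.Disj_iff std.inst_bounded_iff(2)[of ?\<nu>, OF \<nu>] inst_ren
        by auto
      then show "inst LN (case_nat n (\<lambda>i. embed LN LN (?\<theta> (Num LN) i))) (\<lambda>j. embed LN LN (?\<theta> (Set LN) j)) \<Theta> \<in> \<Delta>"
        by simp
    qed
  qed
  have "AllQ LN1 \<phi> \<in> \<Delta>" if AllN: "AllQ LN \<phi> \<in> \<Delta>"
  proof (rule ccontr)
    assume "AllQ LN1 \<phi> \<notin> \<Delta>"
    then obtain c where c: "has_sort c (Num LN1)"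
      and not: "inst LN1 (case_nat c (\<lambda>i. Up (nv LN i))) (\<lambda>j. Up (sv LN j)) \<phi> \<notin> \<Delta>"
      using AllQ_iff[of Var LN1 \<phi>] by auto
    let ?\<nu> = "case_nat c (\<lambda>i. Up (nv LN i))" and ?\<sigma> = "\<lambda>j. Up (?\<theta> (Set LN) j)"
    have \<nu>: "has_sort (case_nat x (\<lambda>i. Up (nv LN i)) i) (Num LN1)" if "has_sort x (Num LN1)" for x i
      using that by (cases i) simp_all
    have \<sigma>: "has_sort (?\<sigma> j) (Set LN1)" for j
      by (cases j) simp_all
    have up: "(\<lambda>i. embed LN1 LStar (case_nat x (\<lambda>i. Up (nv LN i)) i)) =
        case_nat (Up x) (\<lambda>i. embed LN LStar (?\<theta> (Num LN) i))" for x
      by (rule ext) (simp split: nat.split)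
    \<comment> \<open>The transfer rule delivers its conclusion for all nonstandard numbers; Delta-0
      transfer between level 1 and that level carries it to 1-finite arguments and back.\<close>
    have trans: "inst LN1 (case_nat x (\<lambda>i. Up (nv LN i))) ?\<sigma> \<psi> \<in> \<Delta> \<longleftrightarrow>
        inst LStar (case_nat (Up x) (\<lambda>i. embed LN LStar (?\<theta> (Num LN) i)))
          (\<lambda>j. embed LN LStar (?\<theta> (Set LN) j)) \<psi> \<in> \<Delta>" if "has_sort x (Num LN1)" for x \<psi>
      using Delta0_TRANS_iff[of LN1 LStar "case_nat x (\<lambda>i. Up (nv LN i))" ?\<sigma>, OF _ \<nu>[OF that] \<sigma>]
      unfolding up by simp
    have "subst ?\<theta> (AllQ LStar \<Theta>) \<in> \<Delta>" by (rule transfer_mem[OF \<Theta>]) simp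
    then have "inst LN1 ?\<nu> ?\<sigma> \<Theta> \<in> \<Delta>"
      unfolding trans[OF c] AllQ_iff using c by simp
    \<comment> \<open>As \<open>\<phi>\<close> fails at \<open>c\<close>, the second disjunct of
      \<open>\<Theta>\<close> supplies a 1-finite witness.\<close>
    then have "\<exists>p. has_sort p (Num LN1) \<and> inst LN1 (case_nat p ?\<nu>) ?\<sigma> positive_body \<in> \<Delta>"
      using not unfolding \<Theta>_def inst.simps(6) Disj_iff inst_bounded_iff(2)[of ?\<nu>, OF \<nu>[OF c]] inst_ren
      by auto
    \<comment> \<open>The only free number variable of \<open>positive_body\<close> is the code, so
      \<open>c\<close> can be removed from the environment.\<close>
    then obtain p where p: "has_sort p (Num LN1)"
        "inst LN1 (case_nat p (\<lambda>i. Up (nv LN i))) ?\<sigma> positive_body \<in> \<Delta>"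
      unfolding positive_body_cong[of LN1 _ ?\<nu> ?\<sigma> "\<lambda>i. Up (nv LN i)"] by blast
    then have "subst ?\<theta> (ExQ LN1 positive_body) \<in> \<Delta>" by (auto simp: ExQ_iff)
    \<comment> \<open>The same \<open>p\<close>, embedded one level higher, is a nonstandard
      witness; with it both premises in \<open>hyper_double_neg_iff\<close> are available.\<close>
    moreover have "subst ?\<theta> (ExQ LStar positive_body) \<in> \<Delta>"
      unfolding ExQ_iff using p trans[OF p(1)] has_sort_Up(2) by blast
    moreover have "subst ?\<theta> (Imp is_real (hyper_imp (hyper_neg (hyper_neg positive)) positive)) \<in> \<Delta>"
      using extra_axiom_mem[of MPR] unfolding MPR_def by (simp add: Forall_iff subst0_eq)
    moreover have "std_num n \<Longrightarrow> inst LN (case_nat n (nv LN)) (sv LN) \<phi> \<in> \<Delta>" for n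
      using AllN AllQ_iff[of Var LN \<phi>] by simp
    note witness_set_is_zero[OF this]
    ultimately show False
      unfolding positive_eq subst.simps(7) Imp_iff hyper_double_neg_iff by blast
  qed
  then show "A \<in> \<Delta>" by (simp add: A Imp_iff)
qed

theorem mainTheorem4:
  shows "NSA_equivalent MP {MPR} \<and> NSA_equivalent {MPR} Pi1_TRANS_1 \<and> NSA_equivalent MP Pi1_TRANS_1"
proof -
  \<comment> \<open>The implications proved so far form a cycle; the three remaining ones are
    compositions, obtained by cutting out the intermediate axioms.\<close>
  have MP_TRANS: "proves MP {} A" if "A \<in> Pi1_TRANS_1" for A
    using proves_cut_axioms[OF MPR_proves_Pi1_TRANS_1[OF that]] MP_proves_MPR by simp
  have TRANS_MPR: "proves Pi1_TRANS_1 {} MPR"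
    using proves_cut_axioms[OF MP_proves_MPR] Pi1_TRANS_1_proves_MP by blast
  have MPR_MP: "proves {MPR} {} A" if "A \<in> MP" for A
    using proves_cut_axioms[OF Pi1_TRANS_1_proves_MP[OF that]] MPR_proves_Pi1_TRANS_1 by blast
  show ?thesis
    unfolding NSA_equivalent_def
    using MP_proves_MPR MP_TRANS TRANS_MPR MPR_MP MPR_proves_Pi1_TRANS_1 Pi1_TRANS_1_proves_MP by simp
qed

end
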